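(* Let $(W,S)$ be a Coxeter system. If $(W,S)$ is finite, $J\subseteq S$, and $\Gamma$ is a connected $W$-digraph, then $\Gamma_J$ has at most $|W:W_J|$ connected components.
   Context: Coxeter system: $W$ has presentation $\langle s\in S\mid (rs)^{n(r,s)}=e \text{ for } r,s\in S,\ n(r,s)<\infty\rangle$ with $n(s,s)=1$ and $1<n(r,s)=n(s,r)\le\infty$ for $r\ne s$; $\ell$ is the length function. "$(W,S)$ is finite" means $W$ is finite. For $J\subseteq S$, $W_J=\langle J\rangle$, and $|W:W_J|$ is its index in $W$. Hecke algebra: $u$ is an indeterminate and $H$ is the $\mathbb Q(u)$-algebra with basis $\{T_w\mid w\in W\}$ satisfying, for $s\in S$, $T_sT_w=T_{sw}$ if $\ell(sw)>\ell(w)$ and $T_sT_w=u^2T_{sw}+(u^2-1)T_w$ if $\ell(sw)<\ell(w)$. An $S$-labeled digraph is a directed multigraph $\Gamma$ with vertex set $\mathscr V(\Gamma)$ and edge set $\mathscr E(\Gamma)$, in which every edge is either solid or dashed and is labeled by an element of $S$ (written $\alpha\xrightarrow{s}\beta$ if solid, $\alpha\overset{s}{\dashrightarrow}\beta$ if dashed), such that $\Gamma$ has no loops and, for each $s\in S$, every vertex occurs in exactly one edge labeled $s$. Let $M(\Gamma)$ be the $\mathbb Q(u)$-vector space with basis $\mathscr V(\Gamma)$. For $s\in S$ let $\tau_s$ be the linear operator on $M(\Gamma)$ with, for each vertex $\alpha$ (where $\beta$ is the other endpoint of the edge labeled $s$ at $\alpha$): $\tau_s(\alpha)=\beta$ if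 the edge is $\alpha\xrightarrow{s}\beta$; $\tau_s(\alpha)=(u^2-1)\alpha+u^2\beta$ if it is $\beta\xrightarrow{s}\alpha$; $\tau_s(\alpha)=u\alpha+(u+1)\beta$ if it is $\alpha\overset{s}{\dashrightarrow}\beta$; $\tau_s(\alpha)=(u^2-u-1)\alpha+(u^2-u)\beta$ if it is $\beta\overset{s}{\dashrightarrow}\alpha$. An $S$-labeled digraph $\Gamma$ is a $W$-digraph if $T_s\mapsto\tau_s$ ($s\in S$) extends to a homomorphism of $\mathbb Q(u)$-algebras from $H$ to the algebra of all linear operators on $M(\Gamma)$. $\Gamma_J$ is the $J$-labeled digraph with the same vertices obtained from $\Gamma$ by removing all edges with labels in $S\setminus J$. Connectedness and connected components refer to the underlying undirected multigraph. *)

theory Defs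
  imports
    "HOL-Library.Extended_Nat"
    "HOL-Computational_Algebra.Polynomial"
    "HOL-Computational_Algebra.Fraction_Field"
    "Graph_Theory.Digraph_Component"
    "HOL-Algebra.Generated_Groups"
    "HOL-Algebra.Module"
begin

section \<open>Coxeter systems\<close>

text \<open>
  A letter \<open>(x, True)\<close> stands for the generator \<open>x\<close> and \<open>(x, False)\<close> for its formal inverse.
  The quotient of the words over \<open>X\<close> by the congruence below is the group
  with generators \<open>X\<close> and relators \<open>R\<close>.
\<close>

inductive pres_cong :: "'a set \<Rightarrow> ('a \<times> bool) list set \<Rightarrow>
    ('a \<times> bool) list \<Rightarrow> ('a \<times> bool) list \<Rightarrow> bool"
  for X R where
  refl: "pres_cong X R v v"
| sym: "pres_cong X R v w \<Longrightarrow> pres_cong X R w v"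
| trans: "pres_cong X R v w \<Longrightarrow> pres_cong X R w z \<Longrightarrow> pres_cong X R v z"
| append: "pres_cong X R v v' \<Longrightarrow> pres_cong X R w w' \<Longrightarrow> pres_cong X R (v @ w) (v' @ w')"
| cancel: "x \<in> X \<Longrightarrow> pres_cong X R [(x, b), (x, \<not> b)] []"
| relator: "r \<in> R \<Longrightarrow> pres_cong X R r []"

definition eval_word :: "('a, 'm) monoid_scheme \<Rightarrow> ('a \<times> bool) list \<Rightarrow> 'a" where
  "eval_word G v =
     foldr (\<lambda>(x, b) y. (if b then x else inv\<^bsub>G\<^esub> x) \<otimes>\<^bsub>G\<^esub> y) v \<one>\<^bsub>G\<^esub>"

text \<open>The canonical map from the presented group to \<open>G\<close> is well defined and bijective.\<close>

definition has_presentation ::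
  "('a, 'm) monoid_scheme \<Rightarrow> 'a set \<Rightarrow> ('a \<times> bool) list set \<Rightarrow> bool" where
  "has_presentation G X R \<longleftrightarrow>
     group G \<and> X \<subseteq> carrier G \<and> generate G X = carrier G \<and>
     (\<forall>v \<in> lists (X \<times> UNIV). \<forall>w \<in> lists (X \<times> UNIV).
        eval_word G v = eval_word G w \<longleftrightarrow> pres_cong X R v w)"

definition coxeter_matrix :: "'a set \<Rightarrow> ('a \<Rightarrow> 'a \<Rightarrow> enat) \<Rightarrow> bool" where
  "coxeter_matrix S n \<longleftrightarrow>
     (\<forall>s \<in> S. n s s = 1) \<and>
     (\<forall>r \<in> S. \<forall>s \<in> S. r \<noteq> s \<longrightarrow> 1 < n r s \<and> n r s = n s r)"

definition coxeter_relators :: "'a set \<Rightarrow> ('a \<Rightarrow> 'a \<Rightarrow> enat) \<Rightarrow> ('a \<times> bool) list set" where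
  "coxeter_relators S n =
     {concat (replicate k [(r, True), (s, True)]) | r s k. r \<in> S \<and> s \<in> S \<and> n r s = enat k}"

definition coxeter_system :: "('a, 'm) monoid_scheme \<Rightarrow> 'a set \<Rightarrow> bool" where
  "coxeter_system W S \<longleftrightarrow>
     (\<exists>n. coxeter_matrix S n \<and> has_presentation W S (coxeter_relators S n))"

definition cox_length :: "('a, 'm) monoid_scheme \<Rightarrow> 'a set \<Rightarrow> 'a \<Rightarrow> nat" where
  "cox_length W S w =
     (LEAST k. \<exists>xs \<in> lists S. length xs = k \<and> foldr (\<lambda>x y. x \<otimes>\<^bsub>W\<^esub> y) xs \<one>\<^bsub>W\<^esub> = w)"

abbreviation parabolic :: "('a, 'm) monoid_scheme \<Rightarrow> 'a set \<Rightarrow> 'a set" where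
  "parabolic W J \<equiv> generate W J"

definition group_index :: "('a, 'm) monoid_scheme \<Rightarrow> 'a set \<Rightarrow> nat" where
  "group_index G K = card (rcosets\<^bsub>G\<^esub> K)"

section \<open>Algebras over the field of rational functions\<close>

type_synonym ratfun = "rat poly fract"

definition u :: ratfun where
  "u = Fract [:0, 1:] 1"

definition ratfun_ring :: "ratfun ring" where
  "ratfun_ring = \<lparr>carrier = UNIV, monoid.mult = (*), one = 1, zero = 0, add = (+)\<rparr>"

text \<open>
  The locale \<^locale>\<open>algebra\<close> of the library is restricted to commutative algebras.
\<close>

definition assoc_algebra :: "('r, 'm) ring_scheme \<Rightarrow> ('r, 'a, 'n) module_scheme \<Rightarrow> bool" where
  "assoc_algebra R A \<longleftrightarrow>
     module R A \<and> ring A \<and>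
     (\<forall>a \<in> carrier R. \<forall>x \<in> carrier A. \<forall>y \<in> carrier A.
        (a \<odot>\<^bsub>A\<^esub> x) \<otimes>\<^bsub>A\<^esub> y = a \<odot>\<^bsub>A\<^esub> (x \<otimes>\<^bsub>A\<^esub> y) \<and>
        x \<otimes>\<^bsub>A\<^esub> (a \<odot>\<^bsub>A\<^esub> y) = a \<odot>\<^bsub>A\<^esub> (x \<otimes>\<^bsub>A\<^esub> y))"

definition algebra_hom ::
  "('r, 'm) ring_scheme \<Rightarrow> ('r, 'a, 'n) module_scheme \<Rightarrow> ('r, 'b, 'k) module_scheme \<Rightarrow>
     ('a \<Rightarrow> 'b) set" where
  "algebra_hom R A B =
     {h \<in> ring_hom A B. \<forall>a \<in> carrier R. \<forall>x \<in> carrier A. h (a \<odot>\<^bsub>A\<^esub> x) = a \<odot>\<^bsub>B\<^esub> h x}"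

text \<open>
  The coefficient families are pinned to zero outside \<open>I\<close> so that their uniqueness is meaningful.
\<close>

definition indexed_basis ::
  "('r, 'm) ring_scheme \<Rightarrow> ('r, 'a, 'n) module_scheme \<Rightarrow> 'i set \<Rightarrow> ('i \<Rightarrow> 'a) \<Rightarrow> bool" where
  "indexed_basis R M I b \<longleftrightarrow>
     b \<in> I \<rightarrow> carrier M \<and>
     (\<forall>x \<in> carrier M. \<exists>!c.
        (\<forall>i \<in> I. c i \<in> carrier R) \<and> (\<forall>i. i \<notin> I \<longrightarrow> c i = \<zero>\<^bsub>R\<^esub>) \<and>
        finite {i \<in> I. c i \<noteq> \<zero>\<^bsub>R\<^esub>} \<and>
        x = (\<Oplus>\<^bsub>M\<^esub>i \<in> {i \<in> I. c i \<noteq> \<zero>\<^bsub>R\<^esub>}. c i \<odot>\<^bsub>M\<^esub> b i))"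

definition linear_operators ::
  "('r, 'm) ring_scheme \<Rightarrow> ('r, 'a, 'n) module_scheme \<Rightarrow> ('a \<Rightarrow> 'a) set" where
  "linear_operators R M =
     {f \<in> carrier M \<rightarrow>\<^sub>E carrier M.
        (\<forall>x \<in> carrier M. \<forall>y \<in> carrier M. f (x \<oplus>\<^bsub>M\<^esub> y) = f x \<oplus>\<^bsub>M\<^esub> f y) \<and>
        (\<forall>a \<in> carrier R. \<forall>x \<in> carrier M. f (a \<odot>\<^bsub>M\<^esub> x) = a \<odot>\<^bsub>M\<^esub> f x)}"

definition operator_algebra ::
  "('r, 'm) ring_scheme \<Rightarrow> ('r, 'a, 'n) module_scheme \<Rightarrow> ('r, 'a \<Rightarrow> 'a) module" where
  "operator_algebra R M =
     \<lparr>carrier = linear_operators R M,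
      monoid.mult = (\<lambda>f g. compose (carrier M) f g),
      one = (\<lambda>x \<in> carrier M. x),
      zero = (\<lambda>x \<in> carrier M. \<zero>\<^bsub>M\<^esub>),
      add = (\<lambda>f g. \<lambda>x \<in> carrier M. f x \<oplus>\<^bsub>M\<^esub> g x),
      smult = (\<lambda>a f. \<lambda>x \<in> carrier M. a \<odot>\<^bsub>M\<^esub> f x)\<rparr>"

text \<open>
  \<open>H\<close> together with \<open>T\<close> is a Hecke algebra of \<open>(W, S)\<close>; the conditions determine it
  up to isomorphism.
\<close>

definition hecke_algebra ::
  "('a, 'm) monoid_scheme \<Rightarrow> 'a set \<Rightarrow> (ratfun, 'h, 'n) module_scheme \<Rightarrow> ('a \<Rightarrow> 'h) \<Rightarrow> bool" where
  "hecke_algebra W S H T \<longleftrightarrow>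
     assoc_algebra ratfun_ring H \<and>
     indexed_basis ratfun_ring H (carrier W) T \<and>
     (\<forall>s \<in> S. \<forall>w \<in> carrier W.
        (cox_length W S (s \<otimes>\<^bsub>W\<^esub> w) > cox_length W S w \<longrightarrow>
           T s \<otimes>\<^bsub>H\<^esub> T w = T (s \<otimes>\<^bsub>W\<^esub> w)) \<and>
        (cox_length W S (s \<otimes>\<^bsub>W\<^esub> w) < cox_length W S w \<longrightarrow>
           T s \<otimes>\<^bsub>H\<^esub> T w = u\<^sup>2 \<odot>\<^bsub>H\<^esub> T (s \<otimes>\<^bsub>W\<^esub> w) \<oplus>\<^bsub>H\<^esub> (u\<^sup>2 - 1) \<odot>\<^bsub>H\<^esub> T w))"

section \<open>Labeled digraphs\<close>

record ('v, 'e, 's) labeled_digraph =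
  graph_of :: "('v, 'e) pre_digraph"
  label :: "'e \<Rightarrow> 's"
  dashed :: "'e \<Rightarrow> bool"

definition incident_edge :: "('v, 'e, 's) labeled_digraph \<Rightarrow> 's \<Rightarrow> 'v \<Rightarrow> 'e \<Rightarrow> bool" where
  "incident_edge \<Gamma> s \<alpha> e \<longleftrightarrow>
     e \<in> arcs (graph_of \<Gamma>) \<and> label \<Gamma> e = s \<and>
     (tail (graph_of \<Gamma>) e = \<alpha> \<or> head (graph_of \<Gamma>) e = \<alpha>)"

definition S_labeled_digraph :: "'s set \<Rightarrow> ('v, 'e, 's) labeled_digraph \<Rightarrow> bool" where
  "S_labeled_digraph S \<Gamma> \<longleftrightarrow>
     loopfree_digraph (graph_of \<Gamma>) \<and>
     (\<forall>e \<in> arcs (graph_of \<Gamma>). label \<Gamma> e \<in> S) \<and>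
     (\<forall>s \<in> S. \<forall>\<alpha> \<in> verts (graph_of \<Gamma>). \<exists>!e. incident_edge \<Gamma> s \<alpha> e)"

definition restrict_labels ::
  "('v, 'e, 's) labeled_digraph \<Rightarrow> 's set \<Rightarrow> ('v, 'e, 's) labeled_digraph" where
  "restrict_labels \<Gamma> J =
     \<Gamma>\<lparr>graph_of := (graph_of \<Gamma>)\<lparr>arcs := {e \<in> arcs (graph_of \<Gamma>). label \<Gamma> e \<in> J}\<rparr>\<rparr>"

text \<open>
  Note that \<^const>\<open>connected\<close> refers to the underlying undirected graph (and excludes
  the graph without vertices).
\<close>

definition connected_components :: "('v, 'e) pre_digraph \<Rightarrow> ('v, 'e) pre_digraph set" where
  "connected_components G = {C. pre_digraph.max_subgraph G connected C}"

section \<open>The module of a labeled digraph\<close>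

text \<open>
  The vector space with basis \<open>V\<close>, as the finitely supported functions on \<open>V\<close>.
  The fields \<^const>\<open>mult\<close> and \<^const>\<open>one\<close> of the record are irrelevant.
\<close>

definition free_space :: "'v set \<Rightarrow> (ratfun, 'v \<Rightarrow> ratfun) module" where
  "free_space V =
     \<lparr>carrier = {f. finite {\<alpha>. f \<alpha> \<noteq> 0} \<and> {\<alpha>. f \<alpha> \<noteq> 0} \<subseteq> V},
      monoid.mult = undefined, one = undefined,
      zero = (\<lambda>_. 0),
      add = (\<lambda>f g \<gamma>. f \<gamma> + g \<gamma>),
      smult = (\<lambda>a f \<gamma>. a * f \<gamma>)\<rparr>"

definition vertex_vec :: "'v \<Rightarrow> 'v \<Rightarrow> ratfun" where
  "vertex_vec \<alpha> = (\<lambda>\<gamma>. if \<gamma> = \<alpha> then 1 else 0)"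

definition digraph_module :: "('v, 'e, 's) labeled_digraph \<Rightarrow> (ratfun, 'v \<Rightarrow> ratfun) module" where
  "digraph_module \<Gamma> = free_space (verts (graph_of \<Gamma>))"

definition edge_at :: "('v, 'e, 's) labeled_digraph \<Rightarrow> 's \<Rightarrow> 'v \<Rightarrow> 'e" where
  "edge_at \<Gamma> s \<alpha> = (THE e. incident_edge \<Gamma> s \<alpha> e)"

definition tau_vertex :: "('v, 'e, 's) labeled_digraph \<Rightarrow> 's \<Rightarrow> 'v \<Rightarrow> 'v \<Rightarrow> ratfun" where
  "tau_vertex \<Gamma> s \<alpha> =
     (let e = edge_at \<Gamma> s \<alpha>;
          a = tail (graph_of \<Gamma>) e;
          b = head (graph_of \<Gamma>) e
      in if a = \<alpha> then
           (if dashed \<Gamma> e then (\<lambda>\<gamma>. u * vertex_vec \<alpha> \<gamma> + (u + 1) * vertex_vec b \<gamma>)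
            else vertex_vec b)
         else
           (if dashed \<Gamma> e
            then (\<lambda>\<gamma>. (u\<^sup>2 - u - 1) * vertex_vec \<alpha> \<gamma> + (u\<^sup>2 - u) * vertex_vec a \<gamma>)
            else (\<lambda>\<gamma>. (u\<^sup>2 - 1) * vertex_vec \<alpha> \<gamma> + u\<^sup>2 * vertex_vec a \<gamma>)))"

text \<open>The linear extension of \<^const>\<open>tau_vertex\<close>.\<close>

definition tau :: "('v, 'e, 's) labeled_digraph \<Rightarrow> 's \<Rightarrow> ('v \<Rightarrow> ratfun) \<Rightarrow> ('v \<Rightarrow> ratfun)" where
  "tau \<Gamma> s =
     (\<lambda>f \<in> carrier (digraph_module \<Gamma>). \<lambda>\<gamma>. \<Sum>\<alpha> | f \<alpha> \<noteq> 0. f \<alpha> * tau_vertex \<Gamma> s \<alpha> \<gamma>)"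

definition W_digraph ::
  "'a set \<Rightarrow> (ratfun, 'h, 'n) module_scheme \<Rightarrow> ('a \<Rightarrow> 'h) \<Rightarrow>
     ('v, 'e, 'a) labeled_digraph \<Rightarrow> bool" where
  "W_digraph S H T \<Gamma> \<longleftrightarrow>
     S_labeled_digraph S \<Gamma> \<and>
     (\<exists>\<phi> \<in> algebra_hom ratfun_ring H (operator_algebra ratfun_ring (digraph_module \<Gamma>)).
        \<forall>s \<in> S. \<phi> (T s) = tau \<Gamma> s)"

end

theory Submission
  imports Defs
begin

text \<open>
  When \<open>u\<close> is specialized suitably, the operators \<open>\<tau>\<^sub>s\<close> send each vertex to a vertex, up to
  sign. At \<open>u = 0\<close>, for a solid as well as for a dashed edge from \<open>\<alpha>\<close> to \<open>\<beta>\<close>, the operator sends \<open>\<alpha>\<close>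
  to \<open>\<beta>\<close> and \<open>\<beta>\<close> to \<open>- \<beta>\<close>. So up to sign each generator moves a vertex to the head of its
  \<open>s\<close>-edge, and these idempotent maps form an action of the 0-Hecke monoid of \<open>W\<close>: two reduced
  words for the same element act alike, because their products in the Hecke algebra agree. At
  \<open>u = \<infinity>\<close> the inverse operators degenerate in the same way, with the edges reversed, so the
  maps to the tails also form an action of the 0-Hecke monoid
  (\<open>ends_word_consistent\<close>).

  When \<open>W\<close> is finite, the longest element absorbs all generators. In the action by tails it
  therefore sends the ends of any edge to the same vertex, and in a connected digraph it sends all
  vertices to one vertex \<open>\<sigma>\<close>. Read backwards, this says that every vertex is reached from \<open>\<sigma>\<close>
  by the action by heads, so the vertices are the \<open>f w\<close> with \<open>w \<in> W\<close>, where \<open>f w\<close> is the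
  image of \<open>\<sigma>\<close> under \<open>w\<close> (\<open>vertices_indexed_by_group\<close>). For a generator \<open>s\<close>, the vertices
  \<open>f w\<close> and \<open>f (s w)\<close> are equal or joined by an edge labeled \<open>s\<close>. Hence \<open>f w\<close> and \<open>f (h w)\<close>
  with \<open>h \<in> W\<^sub>J\<close> lie in the same component of \<open>\<Gamma>\<^sub>J\<close>, and there are at most as many components
  as right cosets of \<open>W\<^sub>J\<close> (\<open>card_components_le_index\<close>).
\<close>

section \<open>Words in a Coxeter group\<close>

definition word_prod :: "('a, 'm) monoid_scheme \<Rightarrow> 'a list \<Rightarrow> 'a" where
  "word_prod W xs = foldr (\<lambda>x y. x \<otimes>\<^bsub>W\<^esub> y) xs \<one>\<^bsub>W\<^esub>"

definition reduced_word :: "('a, 'm) monoid_scheme \<Rightarrow> 'a set \<Rightarrow> 'a list \<Rightarrow> bool" where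
  "reduced_word W S xs \<longleftrightarrow> xs \<in> lists S \<and> length xs = cox_length W S (word_prod W xs)"

text \<open>
  Operators \<open>D s\<close> with this property yield a well-defined action of every \<open>w \<in> W\<close>,
  through any reduced word. This is what operators of a group algebra, of a Hecke algebra and of
  a 0-Hecke monoid have in common; they differ in the square of \<open>D s\<close>.
\<close>

definition word_consistent ::
  "('a, 'm) monoid_scheme \<Rightarrow> 'a set \<Rightarrow> 'x set \<Rightarrow> ('a \<Rightarrow> 'x \<Rightarrow> 'x) \<Rightarrow> bool" where
  "word_consistent W S X D \<longleftrightarrow>
     (\<forall>s \<in> S. D s \<in> X \<rightarrow> X) \<and>
     (\<forall>xs ys. reduced_word W S xs \<longrightarrow> reduced_word W S ys \<longrightarrow> word_prod W xs = word_prod W ys \<longrightarrow>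
        (\<forall>x \<in> X. foldr D xs x = foldr D ys x))"

lemma word_consistentD:
  assumes "word_consistent W S X D" "reduced_word W S xs" "reduced_word W S ys"
    "word_prod W xs = word_prod W ys" "x \<in> X"
  shows "foldr D xs x = foldr D ys x"
  using assms unfolding word_consistent_def by blast

lemma foldr_closed:
  "xs \<in> lists S \<Longrightarrow> (\<And>s. s \<in> S \<Longrightarrow> D s \<in> X \<rightarrow> X) \<Longrightarrow> x \<in> X \<Longrightarrow> foldr D xs x \<in> X"
  by (induction xs) (auto simp: Pi_iff)

text \<open>
  All relators of a Coxeter group have even length, so the sign of an element is well defined.
\<close>

lemma pres_cong_even_length:
  assumes "pres_cong X R v w" and "\<And>r. r \<in> R \<Longrightarrow> even (length r)"
  shows "even (length v) \<longleftrightarrow> even (length w)"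
  using assms(1) by induction (auto simp: assms(2))

locale coxeter_group = group W for W :: "('a, 'm) monoid_scheme" (structure) +
  fixes S :: "'a set"
  assumes coxeter: "coxeter_system W S"
begin

abbreviation "wp \<equiv> word_prod W"
abbreviation "len \<equiv> cox_length W S"
abbreviation "red \<equiv> reduced_word W S"

lemma wp_simps [simp]: "wp [] = \<one>" "wp (x # xs) = x \<otimes> wp xs"
  by (simp_all add: word_prod_def)

lemma presentation:
  obtains n where "coxeter_matrix S n" "has_presentation W S (coxeter_relators S n)"
  using coxeter by (auto simp: coxeter_system_def)

lemma S_carrier: "S \<subseteq> carrier W"
  using presentation by (auto simp: has_presentation_def)

lemma S_closed [simp, intro]: "s \<in> S \<Longrightarrow> s \<in> carrier W"
  using S_carrier by auto

lemma wp_closed [simp, intro]: "xs \<in> lists S \<Longrightarrow> wp xs \<in> carrier W"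
  by (induction xs) auto

lemma wp_append: "xs \<in> lists S \<Longrightarrow> ys \<in> lists S \<Longrightarrow> wp (xs @ ys) = wp xs \<otimes> wp ys"
  by (induction xs) (auto simp: m_assoc)

lemma eval_word_positive: "xs \<in> lists S \<Longrightarrow> eval_word W (map (\<lambda>x. (x, True)) xs) = wp xs"
  by (induction xs) (auto simp: eval_word_def word_prod_def)

lemma generator_involution [simp]: assumes "s \<in> S" shows "s \<otimes> s = \<one>"
proof -
  obtain n where n: "coxeter_matrix S n" "has_presentation W S (coxeter_relators S n)"
    using presentation .
  have "n s s = enat 1"
    using n(1) assms by (auto simp: coxeter_matrix_def one_enat_def)
  then have "concat (replicate 1 [(s, True), (s, True)]) \<in> coxeter_relators S n"
    unfolding coxeter_relators_def using assms by blast
  then have "pres_cong S (coxeter_relators S n) [(s, True), (s, True)] []"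
    using pres_cong.relator by fastforce
  moreover have "[(s, True), (s, True)] \<in> lists (S \<times> UNIV)"
    "[] \<in> lists (S \<times> (UNIV :: bool set))"
    using assms by auto
  ultimately have "eval_word W [(s, True), (s, True)] = eval_word W []"
    using n(2) unfolding has_presentation_def by blast
  then show ?thesis
    using assms by (simp add: eval_word_def)
qed

lemma generator_inv [simp]: "s \<in> S \<Longrightarrow> inv s = s"
  by (rule inv_equality) auto

lemma generator_cancel [simp]: "s \<in> S \<Longrightarrow> w \<in> carrier W \<Longrightarrow> s \<otimes> (s \<otimes> w) = w"
  by (simp add: m_assoc[symmetric])

lemma word_exists: assumes "w \<in> carrier W" obtains xs where "xs \<in> lists S" "wp xs = w"
proof -
  have "w \<in> generate W S"
    using presentation assms by (auto simp: has_presentation_def)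
  then have "\<exists>xs \<in> lists S. wp xs = w"
  proof induction
    case one
    show ?case by (rule bexI[of _ "[]"]) auto
  next
    case (incl h)
    then show ?case by (intro bexI[of _ "[h]"]) auto
  next
    case (inv h)
    then show ?case by (intro bexI[of _ "[h]"]) auto
  next
    case (eng h1 h2)
    then obtain xs ys where "xs \<in> lists S" "wp xs = h1" "ys \<in> lists S" "wp ys = h2"
      by blast
    then show ?case
      by (intro bexI[of _ "xs @ ys"]) (auto simp: wp_append)
  qed
  then show ?thesis using that by auto
qed

lemma len_le: "xs \<in> lists S \<Longrightarrow> len (wp xs) \<le> length xs"
  unfolding cox_length_def word_prod_def by (rule Least_le) auto

lemma reduced_wordI: "xs \<in> lists S \<Longrightarrow> length xs \<le> len (wp xs) \<Longrightarrow> red xs"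
  using len_le[of xs] by (simp add: reduced_word_def)

lemma reduced_exists: assumes "w \<in> carrier W" obtains xs where "red xs" "wp xs = w"
proof -
  obtain ys where "ys \<in> lists S" "wp ys = w" using word_exists[OF assms] .
  then have "\<exists>k. \<exists>xs \<in> lists S. length xs = k \<and> wp xs = w"
    by blast
  then have "\<exists>xs \<in> lists S. length xs = len w \<and> wp xs = w"
    unfolding cox_length_def word_prod_def by (rule LeastI_ex)
  then show ?thesis using that by (auto simp: reduced_word_def)
qed

lemma word_length_parity:
  assumes "xs \<in> lists S" "ys \<in> lists S" "wp xs = wp ys"
  shows "even (length xs) \<longleftrightarrow> even (length ys)"
proof -
  obtain n where n: "coxeter_matrix S n" "has_presentation W S (coxeter_relators S n)"
    using presentation .
  let ?l = "map (\<lambda>x. (x, True))"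
  have "?l xs \<in> lists (S \<times> UNIV)" "?l ys \<in> lists (S \<times> UNIV)"
    using assms by auto
  moreover have "eval_word W (?l xs) = eval_word W (?l ys)"
    using assms by (simp add: eval_word_positive)
  ultimately have "pres_cong S (coxeter_relators S n) (?l xs) (?l ys)"
    using n(2) unfolding has_presentation_def by blast
  moreover have "even (length r)" if "r \<in> coxeter_relators S n" for r
    using that by (auto simp: coxeter_relators_def length_concat sum_list_replicate)
  ultimately show ?thesis
    using pres_cong_even_length[of S _ "?l xs" "?l ys"] by simp
qed

lemma cox_length_parity: assumes "xs \<in> lists S" shows "even (length xs) \<longleftrightarrow> even (len (wp xs))"
proof -
  obtain ys where "red ys" "wp ys = wp xs" using reduced_exists[OF wp_closed[OF assms]] .
  then show ?thesis using word_length_parity[OF assms, of ys] by (simp add: reduced_word_def)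
qed

lemma reduced_tail: assumes "red (x # xs)" shows "red xs"
proof (rule reduced_wordI)
  show xs: "xs \<in> lists S" using assms by (simp add: reduced_word_def)
  obtain ys where ys: "red ys" "wp ys = wp xs"
    using reduced_exists[OF wp_closed[OF xs]] .
  have "len (wp (x # ys)) \<le> length (x # ys)"
    using assms ys by (intro len_le) (auto simp: reduced_word_def)
  then show "length xs \<le> len (wp xs)"
    using assms ys by (simp add: reduced_word_def)
qed

text \<open>
  Multiplying by a generator changes the parity of the length, hence the length itself. So if
  \<open>s\<close> does not lengthen \<open>w\<close>, it shortens it, and \<open>w\<close> has a reduced word that begins with \<open>s\<close>.
\<close>

lemma not_reduced_Cons:
  assumes "red xs" "s \<in> S" "\<not> red (s # xs)"
  obtains zs where "red (s # zs)" "wp (s # zs) = wp xs" "wp zs = s \<otimes> wp xs"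
proof -
  have xs: "xs \<in> lists S" "length xs = len (wp xs)"
    using assms by (auto simp: reduced_word_def)
  have "len (wp (s # xs)) \<noteq> Suc (length xs)" "len (wp (s # xs)) \<le> Suc (length xs)"
    using assms len_le[of "s # xs"] xs by (auto simp: reduced_word_def)
  moreover have "even (len (wp (s # xs))) \<longleftrightarrow> odd (length xs)"
    using cox_length_parity[of "s # xs"] xs assms by simp
  ultimately have less: "len (wp (s # xs)) < length xs"
    by (metis le_Suc_eq order_le_less)
  obtain zs where zs: "red zs" "wp zs = wp (s # xs)"
    using reduced_exists[of "wp (s # xs)"] assms(2) xs(1) by auto
  have eq: "wp (s # zs) = wp xs"
    using zs assms(2) xs by simp
  moreover have "red (s # zs)"
    using zs assms less xs eq by (intro reduced_wordI) (auto simp: reduced_word_def)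
  ultimately show ?thesis using that zs by simp
qed

lemma wp_rev: "xs \<in> lists S \<Longrightarrow> wp (rev xs) = inv (wp xs)"
proof (induction xs)
  case (Cons x xs)
  then have "rev xs \<in> lists S" "[x] \<in> lists S" by auto
  then show ?case using Cons by (simp add: wp_append inv_mult_group)
qed simp

lemma reduced_rev: assumes "red xs" shows "red (rev xs)"
proof (rule reduced_wordI)
  have xs: "xs \<in> lists S" "length xs = len (wp xs)"
    using assms by (auto simp: reduced_word_def)
  then show rev: "rev xs \<in> lists S" by auto
  obtain ys where ys: "red ys" "wp ys = wp (rev xs)"
    using reduced_exists[OF wp_closed[OF rev]] .
  then have ysS: "ys \<in> lists S" "rev ys \<in> lists S" by (auto simp: reduced_word_def)
  then have "wp (rev ys) = wp xs"
    using xs ys by (simp add: wp_rev)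
  then have "len (wp xs) \<le> length (rev ys)"
    using len_le[OF ysS(2)] by simp
  then show "length (rev xs) \<le> len (wp (rev xs))"
    using ys xs by (simp add: reduced_word_def)
qed

text \<open>
  For idempotent operators, words act like elements of the 0-Hecke monoid: a letter \<open>s\<close> that would
  spoil reducedness can be dropped, because the reduced word after it can be rewritten to begin
  with \<open>s\<close>, and applying \<open>D s\<close> twice is the same as applying it once.
\<close>

lemma orbit_reduced:
  assumes "word_consistent W S X D"
    and idem: "\<And>s x. s \<in> S \<Longrightarrow> x \<in> X \<Longrightarrow> D s (D s x) = D s x"
    and "xs \<in> lists S" "x \<in> X"
  obtains ys where "red ys" "foldr D ys x = foldr D xs x"
proof -
  have "\<exists>ys. red ys \<and> foldr D ys x = foldr D xs x"
    using assms(3)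
  proof (induction xs)
    case Nil
    have "red []" by (rule reduced_wordI) auto
    then show ?case by auto
  next
    case (Cons s xs)
    then obtain ys where ys: "red ys" "foldr D ys x = foldr D xs x" by auto
    show ?case
    proof (cases "red (s # ys)")
      case True
      then show ?thesis using ys by (intro exI[of _ "s # ys"]) simp
    next
      case False
      then obtain zs where zs: "red (s # zs)" "wp (s # zs) = wp ys"
        using not_reduced_Cons ys Cons.hyps by metis
      then have "foldr D ys x = foldr D (s # zs) x"
        using word_consistentD[OF assms(1) ys(1) zs(1)] zs(2) assms(4) by simp
      then have "foldr D ys x = D s (foldr D zs x)" by simp
      moreover have "foldr D zs x \<in> X"
        using zs assms(1,4)
        by (intro foldr_closed[of _ S]) (auto simp: reduced_word_def word_consistent_def)
      ultimately show ?thesis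
        using ys idem Cons.hyps by (intro exI[of _ ys]) auto
    qed
  qed
  then show ?thesis using that by auto
qed

text \<open>
  A longest element of \<open>W\<close> has, for each \<open>s\<close>, a reduced word that ends in \<open>s\<close>; idempotency of
  \<open>D s\<close> then makes a further \<open>s\<close> on the right ineffective.
\<close>

lemma longest_word_absorbs:
  assumes "finite (carrier W)" "word_consistent W S X D"
    and idem: "\<And>s x. s \<in> S \<Longrightarrow> x \<in> X \<Longrightarrow> D s (D s x) = D s x"
  obtains xs where "xs \<in> lists S"
    "\<And>s x. s \<in> S \<Longrightarrow> x \<in> X \<Longrightarrow> foldr D xs (D s x) = foldr D xs x"
proof -
  let ?m = "Max (len ` carrier W)"
  have "?m \<in> len ` carrier W"
    using assms(1) by (intro Max_in) auto
  then obtain w where w: "w \<in> carrier W" "len w = ?m"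
    by auto
  have max: "len v \<le> len w" if "v \<in> carrier W" for v
    using that assms(1) w by auto
  obtain xs where xs: "red xs" "wp xs = w"
    using reduced_exists[OF w(1)] .
  have xsS: "xs \<in> lists S" "length xs = len w"
    using xs by (auto simp: reduced_word_def)
  have "foldr D xs (D s x) = foldr D xs x" if s: "s \<in> S" and x: "x \<in> X" for s x
  proof -
    have ws: "w \<otimes> s \<in> carrier W" using s w by auto
    obtain zs where zs: "red zs" "wp zs = w \<otimes> s"
      using reduced_exists[OF ws] .
    have zsS: "zs \<in> lists S" "length zs = len (w \<otimes> s)"
      using zs by (auto simp: reduced_word_def)
    have "wp (xs @ [s]) = w \<otimes> s"
      using xs xsS s by (simp add: wp_append)
    then have "even (len (w \<otimes> s)) \<longleftrightarrow> odd (len w)"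
      using cox_length_parity[of "xs @ [s]"] xsS s by auto
    then have less: "len (w \<otimes> s) < len w"
      using max[OF ws] by (metis order_le_less)
    have eq: "wp (zs @ [s]) = w"
      using zs zsS s w by (simp add: wp_append m_assoc)
    have "red (zs @ [s])"
      using less eq zsS s by (intro reduced_wordI) auto
    then have *: "foldr D xs y = foldr D (zs @ [s]) y" if "y \<in> X" for y
      using word_consistentD[OF assms(2) xs(1) _ _ that] xs(2) eq by simp
    have "D s x \<in> X" using assms(2) s x by (auto simp: word_consistent_def)
    then show ?thesis
      using *[of x] *[of "D s x"] idem s x by simp
  qed
  then show ?thesis using that xsS by blast
qed

text \<open>
  The inverse of a product along a word is the product of the inverses along the reversed word,
  and reversing a reduced word for \<open>w\<close> gives a reduced word for the inverse of \<open>w\<close>.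
\<close>

lemma inverse_word_consistent:
  assumes "word_consistent W S X D"
    and E: "\<And>s. s \<in> S \<Longrightarrow> E s \<in> X \<rightarrow> X"
    and DE: "\<And>s x. s \<in> S \<Longrightarrow> x \<in> X \<Longrightarrow> D s (E s x) = x"
    and ED: "\<And>s x. s \<in> S \<Longrightarrow> x \<in> X \<Longrightarrow> E s (D s x) = x"
  shows "word_consistent W S X E"
proof -
  have D: "\<And>s. s \<in> S \<Longrightarrow> D s \<in> X \<rightarrow> X"
    using assms(1) by (auto simp: word_consistent_def)
  have 1: "foldr D (rev xs) (foldr E xs x) = x" if "xs \<in> lists S" "x \<in> X" for xs x
    using that
  proof (induction xs)
    case (Cons s xs)
    then show ?case using DE foldr_closed[of xs S E X x] E by simp
  qed simp
  have 2: "foldr E xs (foldr D (rev xs) x) = x" if "xs \<in> lists S" "x \<in> X" for xs x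
    using that
  proof (induction xs arbitrary: x)
    case (Cons s xs)
    then have "D s x \<in> X" using D by (auto simp: Pi_iff)
    then show ?case using ED Cons by simp
  qed simp
  have "foldr E xs x = foldr E ys x"
    if r: "red xs" "red ys" "wp xs = wp ys" and x: "x \<in> X" for xs ys x
  proof -
    have S: "xs \<in> lists S" "ys \<in> lists S" using r by (auto simp: reduced_word_def)
    let ?y = "foldr E xs x"
    have y: "?y \<in> X" using S x E by (intro foldr_closed[of _ S]) auto
    have "wp (rev xs) = wp (rev ys)" using r S by (simp add: wp_rev)
    then have "foldr D (rev ys) ?y = foldr D (rev xs) ?y"
      using word_consistentD[OF assms(1) reduced_rev[OF r(2)] reduced_rev[OF r(1)] _ y] by simp
    then show ?thesis
      using 1[OF S(1) x] 2[OF S(2) y] by simp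
  qed
  then show ?thesis using E unfolding word_consistent_def by blast
qed

text \<open>
  Here \<open>P w\<close> is the operator of the basis element \<open>T\<^sub>w\<close>. The induction starts with words of
  length one, where the hypothesis identifies the operator; the empty word is treated apart, as the
  only reduced word for the identity.
\<close>

lemma word_consistent_if_hecke_rule:
  fixes D :: "'a \<Rightarrow> 'x \<Rightarrow> 'x" and P :: "'a \<Rightarrow> 'x \<Rightarrow> 'x"
  assumes D: "\<And>s. s \<in> S \<Longrightarrow> D s \<in> X \<rightarrow> X"
    and gen: "\<And>s x. s \<in> S \<Longrightarrow> x \<in> X \<Longrightarrow> P s x = D s x"
    and rule: "\<And>s w x. s \<in> S \<Longrightarrow> w \<in> carrier W \<Longrightarrow> len w < len (s \<otimes> w) \<Longrightarrow> x \<in> X \<Longrightarrow>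
      P (s \<otimes> w) x = D s (P w x)"
  shows "word_consistent W S X D"
proof -
  have P: "foldr D xs x = P (wp xs) x" if "red xs" "xs \<noteq> []" "x \<in> X" for xs x
    using that
  proof (induction xs)
    case (Cons s xs)
    have s: "s \<in> S" "xs \<in> lists S" using Cons.prems by (auto simp: reduced_word_def)
    show ?case
    proof (cases "xs = []")
      case True
      then show ?thesis using s gen Cons.prems by simp
    next
      case False
      have red: "red xs" using Cons.prems reduced_tail by blast
      then have "len (wp xs) < len (s \<otimes> wp xs)"
        using Cons.prems by (auto simp: reduced_word_def)
      then show ?thesis
        using rule[of s "wp xs" x] s Cons.IH[OF red False] Cons.prems by simp
    qed
  qed simp
  have "foldr D xs x = foldr D ys x"
    if "red xs" "red ys" "wp xs = wp ys" "x \<in> X" for xs ys x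
  proof (cases "xs = []")
    case True
    then show ?thesis using that by (auto simp: reduced_word_def)
  next
    case False
    then have "ys \<noteq> []" using that by (auto simp: reduced_word_def)
    then show ?thesis using P that False by metis
  qed
  then show ?thesis using D unfolding word_consistent_def by blast
qed

end

section \<open>Specialization at zero and at infinity\<close>

text \<open>
  \<open>R\<close> is a ring of rational functions that can be specialized at a point and \<open>I\<close> the ideal of
  those that vanish there. Working modulo \<open>I\<close> replaces the specialization itself.
\<close>

locale coefficient_ideal =
  fixes R I :: "ratfun set"
  assumes one_R: "1 \<in> R"
    and diff_R: "x \<in> R \<Longrightarrow> y \<in> R \<Longrightarrow> x - y \<in> R"
    and mult_R: "x \<in> R \<Longrightarrow> y \<in> R \<Longrightarrow> x * y \<in> R"
    and I_sub: "I \<subseteq> R"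
    and zero_I: "0 \<in> I"
    and diff_I: "x \<in> I \<Longrightarrow> y \<in> I \<Longrightarrow> x - y \<in> I"
    and mult_I: "x \<in> I \<Longrightarrow> y \<in> R \<Longrightarrow> x * y \<in> I"
    and one_notin_I: "1 \<notin> I"
begin

lemma uminus_I: "x \<in> I \<Longrightarrow> - x \<in> I"
  using diff_I[OF zero_I, of x] by simp

lemma add_I: "x \<in> I \<Longrightarrow> y \<in> I \<Longrightarrow> x + y \<in> I"
  using diff_I[OF _ uminus_I, of x y] by simp

lemma zero_R: "0 \<in> R"
  using zero_I I_sub by auto

lemma uminus_R: "x \<in> R \<Longrightarrow> - x \<in> R"
  using diff_R[OF zero_R, of x] by simp

lemma add_R: "x \<in> R \<Longrightarrow> y \<in> R \<Longrightarrow> x + y \<in> R"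
  using diff_R[OF _ uminus_R, of x y] by simp

lemma mult_I': "x \<in> R \<Longrightarrow> y \<in> I \<Longrightarrow> x * y \<in> I"
  using mult_I[of y x] by (simp add: mult.commute)

lemmas ideal_intros = add_I diff_I uminus_I mult_I mult_I' zero_I
  add_R diff_R uminus_R mult_R one_R zero_R subsetD[OF I_sub]

lemma cong_notin_I: "x - y \<in> I \<Longrightarrow> x \<in> I \<longleftrightarrow> y \<in> I"
  using diff_I[of x "x - y"] add_I[of "x - y" y] by auto

text \<open>
  Such an \<open>x\<close> specializes to a nonzero multiple of the single vertex \<open>\<gamma>\<close>.
\<close>

definition leading :: "('v \<Rightarrow> ratfun) \<Rightarrow> 'v \<Rightarrow> bool" where
  "leading x \<gamma> \<longleftrightarrow> (\<forall>\<delta>. x \<delta> \<in> R \<and> (x \<delta> \<in> I \<longleftrightarrow> \<delta> \<noteq> \<gamma>))"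

lemma leading_unique: "leading x \<gamma> \<Longrightarrow> leading x \<delta> \<Longrightarrow> \<gamma> = \<delta>"
  by (auto simp: leading_def)

lemma leading_vertex_vec: "leading (vertex_vec \<gamma>) \<gamma>"
  using one_notin_I by (auto simp: leading_def vertex_vec_def ideal_intros)

text \<open>
  The two ends of the edge at \<open>\<gamma>\<close> are \<open>p \<gamma>\<close> and \<open>q \<gamma>\<close>, and each of \<open>p\<close> and \<open>q\<close> is constant on it.
  Modulo \<open>I\<close> the vector \<open>y\<close> arises from \<open>x\<close> by the operator that sends the end \<open>p \<gamma>\<close> to \<open>q \<gamma>\<close>
  and \<open>q \<gamma>\<close> to \<open>- q \<gamma>\<close>. Up to sign, a vertex thus moves to \<open>q \<gamma>\<close>, whichever end of its edge
  it is.
\<close>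

lemma leading_step:
  fixes p q :: "'v \<Rightarrow> 'v"
  assumes x: "leading x \<gamma>" and "\<gamma> \<in> V"
    and ends: "\<And>\<delta>. \<delta> \<in> V \<Longrightarrow> \<delta> \<in> {p \<delta>, q \<delta>} \<and> p \<delta> \<noteq> q \<delta> \<and> q \<delta> \<in> V \<and>
      p (p \<delta>) = p \<delta> \<and> p (q \<delta>) = p \<delta> \<and> q (p \<delta>) = q \<delta> \<and> q (q \<delta>) = q \<delta>"
    and outside: "\<And>\<delta>. \<delta> \<notin> V \<Longrightarrow> y \<delta> = 0"
    and at_p: "\<And>\<delta>. \<delta> \<in> V \<Longrightarrow> p \<delta> = \<delta> \<Longrightarrow> y \<delta> \<in> I"
    and at_q: "\<And>\<delta>. \<delta> \<in> V \<Longrightarrow> q \<delta> = \<delta> \<Longrightarrow> y \<delta> - (x (p \<delta>) - x \<delta>) \<in> I"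
  shows "leading y (q \<gamma>)"
  unfolding leading_def
proof (intro allI)
  fix \<delta>
  have xR: "x \<epsilon> \<in> R" and xI: "x \<epsilon> \<in> I \<longleftrightarrow> \<epsilon> \<noteq> \<gamma>" for \<epsilon>
    using x by (auto simp: leading_def)
  show "y \<delta> \<in> R \<and> (y \<delta> \<in> I \<longleftrightarrow> \<delta> \<noteq> q \<gamma>)"
  proof (cases "\<delta> \<in> V \<and> q \<delta> = \<delta>")
    case True
    then have d: "\<delta> \<in> V" "q \<delta> = \<delta>" "p \<delta> \<noteq> \<delta>" using ends[of \<delta>] by auto
    define c where "c = y \<delta> - (x (p \<delta>) - x \<delta>)"
    have c: "c \<in> I" using at_q d by (simp add: c_def)
    have "y \<delta> = c + (x (p \<delta>) - x \<delta>)" by (simp add: c_def)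
    then have "y \<delta> \<in> R" using c xR by (simp add: ideal_intros)
    moreover have "y \<delta> \<in> I \<longleftrightarrow> x (p \<delta>) - x \<delta> \<in> I"
      using cong_notin_I c by (simp add: c_def)
    moreover have "x (p \<delta>) - x \<delta> \<in> I \<longleftrightarrow> \<delta> \<noteq> q \<gamma>"
    proof (cases "\<delta> = q \<gamma>")
      case True
      \<comment> \<open>Exactly one of the two ends carries the leading coordinate, so there is no cancellation.\<close>
      then have "\<gamma> = \<delta> \<or> \<gamma> = p \<delta>" using ends[OF \<open>\<gamma> \<in> V\<close>] by auto
      then consider "x \<delta> \<notin> I" "x (p \<delta>) \<in> I" | "x \<delta> \<in> I" "x (p \<delta>) \<notin> I"
        using xI d by metis
      then have "x (p \<delta>) - x \<delta> \<notin> I"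
      proof cases
        case 1
        then show ?thesis using diff_I[of "x (p \<delta>)" "x (p \<delta>) - x \<delta>"] by auto
      next
        case 2
        then show ?thesis using add_I[of "x (p \<delta>) - x \<delta>" "x \<delta>"] by auto
      qed
      then show ?thesis using True by simp
    next
      case False
      then have "\<gamma> \<noteq> \<delta>" "\<gamma> \<noteq> p \<delta>" using ends[OF d(1)] d by auto
      then show ?thesis using xI False by (simp add: ideal_intros)
    qed
    ultimately show ?thesis by blast
  next
    case False
    have "y \<delta> \<in> I"
    proof (cases "\<delta> \<in> V")
      case True
      then have "p \<delta> = \<delta>" using False ends[OF True] by auto
      then show ?thesis using at_p True by blast
    next
      case False
      then show ?thesis using outside zero_I by simp
    qed
    moreover have "\<delta> \<noteq> q \<gamma>" using False ends[OF \<open>\<gamma> \<in> V\<close>] by auto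
    ultimately show ?thesis using I_sub by auto
  qed
qed

end

lemma coefficient_ideal_at_zero:
  "coefficient_ideal (range (\<lambda>p. Fract p 1)) ((\<lambda>p. Fract p 1) ` {p. poly p 0 = 0})"
proof
  show "1 \<in> range (\<lambda>p :: rat poly. Fract p 1)" by (auto simp: One_fract_def)
  show "0 \<in> (\<lambda>p :: rat poly. Fract p 1) ` {p. poly p 0 = 0}"
    by (intro image_eqI[of _ _ 0]) (auto simp: Zero_fract_def)
  show "1 \<notin> (\<lambda>p :: rat poly. Fract p 1) ` {p. poly p 0 = 0}"
    by (auto simp: One_fract_def eq_fract)
qed (auto intro!: image_eqI[where f = "\<lambda>p. Fract p 1"])

lemma u_in_ideal_at_zero: "u \<in> (\<lambda>p. Fract p 1) ` {p. poly p 0 = 0}"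
  unfolding u_def by (intro image_eqI[of _ _ "[:0, 1:]"]) auto

text \<open>
  A polynomial counts as positive if its leading coefficient is, so \<open>u\<close> is
  infinitely large in the ordered field of rational functions.
\<close>

lemma of_nat_less_u: "of_nat n < u"
proof -
  have "(0 :: rat poly) < [:0, 1:] - [:of_nat n:]"
    by (simp add: less_poly_def pos_poly_pCons)
  then have "[:of_nat n:] < ([:0, 1:] :: rat poly)"
    by (simp only: diff_gt_0_iff_gt)
  then show ?thesis
    by (simp add: u_def of_nat_fract of_nat_poly)
qed

lemma u_pos: "0 < u"
  using of_nat_less_u[of 0] by simp

text \<open>
  The elements of bounded absolute value are the rational functions without a pole at infinity,
  and the infinitesimal ones are those that vanish at infinity.
\<close>

definition bounded_ratfun :: "ratfun set" where
  "bounded_ratfun = {x. \<exists>n. \<bar>x\<bar> \<le> of_nat n}"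

definition infinitesimal_ratfun :: "ratfun set" where
  "infinitesimal_ratfun = {x. \<forall>n. of_nat n * \<bar>x\<bar> < 1}"

lemma coefficient_ideal_at_infinity: "coefficient_ideal bounded_ratfun infinitesimal_ratfun"
proof
  show "1 \<in> bounded_ratfun" by (auto simp: bounded_ratfun_def intro: exI[of _ 1])
  show "0 \<in> infinitesimal_ratfun" by (simp add: infinitesimal_ratfun_def)
  show "1 \<notin> infinitesimal_ratfun" by (auto simp: infinitesimal_ratfun_def intro: exI[of _ 1])
  show "infinitesimal_ratfun \<subseteq> bounded_ratfun"
    by (auto simp: infinitesimal_ratfun_def bounded_ratfun_def dest: spec[of _ 1]
        intro!: exI[of _ 1])
next
  fix x y assume "x \<in> bounded_ratfun" "y \<in> bounded_ratfun"
  then obtain m n where mn: "\<bar>x\<bar> \<le> of_nat m" "\<bar>y\<bar> \<le> of_nat n"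
    by (auto simp: bounded_ratfun_def)
  have "\<bar>x - y\<bar> \<le> of_nat (m + n)"
    using mn abs_triangle_ineq4[of x y] by simp
  then show "x - y \<in> bounded_ratfun" unfolding bounded_ratfun_def by blast
  have "\<bar>x * y\<bar> \<le> of_nat (m * n)"
    using mn by (simp add: abs_mult mult_mono)
  then show "x * y \<in> bounded_ratfun" unfolding bounded_ratfun_def by blast
next
  fix x y assume xy: "x \<in> infinitesimal_ratfun" "y \<in> infinitesimal_ratfun"
  have "of_nat n * \<bar>x - y\<bar> < 1" for n
  proof -
    have "of_nat (2 * n) * \<bar>x\<bar> < 1" "of_nat (2 * n) * \<bar>y\<bar> < 1"
      using xy unfolding infinitesimal_ratfun_def by blast+
    moreover have "of_nat n * \<bar>x - y\<bar> \<le> of_nat n * (\<bar>x\<bar> + \<bar>y\<bar>)"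
      by (intro mult_left_mono abs_triangle_ineq4) simp
    ultimately show ?thesis by (simp add: algebra_simps)
  qed
  then show "x - y \<in> infinitesimal_ratfun" by (simp add: infinitesimal_ratfun_def)
next
  fix x y assume x: "x \<in> infinitesimal_ratfun" and "y \<in> bounded_ratfun"
  then obtain m where m: "\<bar>y\<bar> \<le> of_nat m" by (auto simp: bounded_ratfun_def)
  have "of_nat n * \<bar>x * y\<bar> < 1" for n
  proof -
    have "of_nat n * (\<bar>x\<bar> * \<bar>y\<bar>) \<le> of_nat n * (\<bar>x\<bar> * of_nat m)"
      using m by (intro mult_left_mono) auto
    also have "\<dots> = of_nat (n * m) * \<bar>x\<bar>" by simp
    also have "\<dots> < 1" using x unfolding infinitesimal_ratfun_def by blast
    finally show ?thesis by (simp add: abs_mult)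
  qed
  then show "x * y \<in> infinitesimal_ratfun" by (simp add: infinitesimal_ratfun_def)
qed

lemma inverse_u_infinitesimal: "1 / u \<in> infinitesimal_ratfun"
  using of_nat_less_u u_pos by (simp add: infinitesimal_ratfun_def divide_less_eq)

section \<open>The generators acting on the module of a labeled digraph\<close>

definition source_end :: "('v, 'e, 's) labeled_digraph \<Rightarrow> 's \<Rightarrow> 'v \<Rightarrow> 'v" where
  "source_end \<Gamma> s \<alpha> = tail (graph_of \<Gamma>) (edge_at \<Gamma> s \<alpha>)"

definition target_end :: "('v, 'e, 's) labeled_digraph \<Rightarrow> 's \<Rightarrow> 'v \<Rightarrow> 'v" where
  "target_end \<Gamma> s \<alpha> = head (graph_of \<Gamma>) (edge_at \<Gamma> s \<alpha>)"

locale labeled_graph =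
  fixes S :: "'s set" and \<Gamma> :: "('v, 'e, 's) labeled_digraph"
  assumes labeled: "S_labeled_digraph S \<Gamma>"
begin

abbreviation "V \<equiv> verts (graph_of \<Gamma>)"
abbreviation "src \<equiv> source_end \<Gamma>"
abbreviation "dst \<equiv> target_end \<Gamma>"
abbreviation "M \<equiv> digraph_module \<Gamma>"

sublocale loopfree_digraph "graph_of \<Gamma>"
  using labeled by (simp add: S_labeled_digraph_def)

lemma edge_at:
  assumes "s \<in> S" "\<alpha> \<in> V" shows "incident_edge \<Gamma> s \<alpha> (edge_at \<Gamma> s \<alpha>)"
proof -
  have "\<exists>!e. incident_edge \<Gamma> s \<alpha> e"
    using labeled assms by (simp add: S_labeled_digraph_def)
  then show ?thesis unfolding edge_at_def by (rule theI')
qed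

lemma edge_at_eqI:
  assumes "s \<in> S" "\<alpha> \<in> V" "incident_edge \<Gamma> s \<alpha> e" shows "edge_at \<Gamma> s \<alpha> = e"
proof -
  have "\<exists>!e. incident_edge \<Gamma> s \<alpha> e"
    using labeled assms(1,2) by (simp add: S_labeled_digraph_def)
  then show ?thesis using edge_at[OF assms(1,2)] assms(3) by blast
qed

lemma ends:
  assumes "s \<in> S" "\<alpha> \<in> V"
  shows ends_closed: "src s \<alpha> \<in> V" "dst s \<alpha> \<in> V"
    and ends_distinct: "src s \<alpha> \<noteq> dst s \<alpha>"
    and ends_cases: "\<alpha> = src s \<alpha> \<or> \<alpha> = dst s \<alpha>"
    and edge_at_src: "edge_at \<Gamma> s (src s \<alpha>) = edge_at \<Gamma> s \<alpha>"
    and edge_at_dst: "edge_at \<Gamma> s (dst s \<alpha>) = edge_at \<Gamma> s \<alpha>"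
proof -
  have e: "edge_at \<Gamma> s \<alpha> \<in> arcs (graph_of \<Gamma>)" "label \<Gamma> (edge_at \<Gamma> s \<alpha>) = s"
    using edge_at[OF assms] by (auto simp: incident_edge_def)
  show V: "src s \<alpha> \<in> V" "dst s \<alpha> \<in> V"
    using e by (auto simp: source_end_def target_end_def)
  show "src s \<alpha> \<noteq> dst s \<alpha>"
    using e no_loops by (auto simp: source_end_def target_end_def)
  show "\<alpha> = src s \<alpha> \<or> \<alpha> = dst s \<alpha>"
    using edge_at[OF assms] by (auto simp: incident_edge_def source_end_def target_end_def)
  show "edge_at \<Gamma> s (src s \<alpha>) = edge_at \<Gamma> s \<alpha>"
    by (rule edge_at_eqI[OF assms(1) V(1)]) (use e in \<open>auto simp: incident_edge_def source_end_def\<close>)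
  show "edge_at \<Gamma> s (dst s \<alpha>) = edge_at \<Gamma> s \<alpha>"
    by (rule edge_at_eqI[OF assms(1) V(2)]) (use e in \<open>auto simp: incident_edge_def target_end_def\<close>)
qed

lemma ends_idem:
  assumes "s \<in> S" "\<alpha> \<in> V"
  shows "src s (src s \<alpha>) = src s \<alpha>" "src s (dst s \<alpha>) = src s \<alpha>"
    "dst s (src s \<alpha>) = dst s \<alpha>" "dst s (dst s \<alpha>) = dst s \<alpha>"
  using edge_at_src[OF assms] edge_at_dst[OF assms] by (simp_all add: source_end_def target_end_def)

lemma tau_outside:
  assumes "s \<in> S" "x \<in> carrier M" "\<delta> \<notin> V"
  shows "tau \<Gamma> s x \<delta> = 0"
proof -
  have "tau_vertex \<Gamma> s \<alpha> \<delta> = 0" if "x \<alpha> \<noteq> 0" for \<alpha>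
  proof -
    have "\<alpha> \<in> V" using that assms(2) by (auto simp: digraph_module_def free_space_def)
    then show ?thesis
      using ends_closed[OF assms(1), of \<alpha>] assms(3)
      by (auto simp: tau_vertex_def Let_def vertex_vec_def source_end_def target_end_def)
  qed
  then show ?thesis using assms(2) by (simp add: tau_def)
qed

text \<open>
  The row \<open>\<delta>\<close> of the matrix of \<open>tau \<Gamma> s\<close>: its entries in the columns of the tail and of the head
  of the edge at \<open>\<delta>\<close>. All other entries of the row vanish.
\<close>

definition tau_coeff :: "'s \<Rightarrow> 'v \<Rightarrow> ratfun \<times> ratfun" where
  "tau_coeff s \<delta> =
     (if dashed \<Gamma> (edge_at \<Gamma> s \<delta>) then
        if \<delta> = src s \<delta> then (u, u\<^sup>2 - u) else (u + 1, u\<^sup>2 - u - 1)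
      else
        if \<delta> = src s \<delta> then (0, u\<^sup>2) else (1, u\<^sup>2 - 1))"

lemma tau_at:
  assumes "s \<in> S" "x \<in> carrier M" "\<delta> \<in> V"
  shows "tau \<Gamma> s x \<delta> =
    fst (tau_coeff s \<delta>) * x (src s \<delta>) + snd (tau_coeff s \<delta>) * x (dst s \<delta>)"
proof -
  let ?f = "\<lambda>\<alpha>. x \<alpha> * tau_vertex \<Gamma> s \<alpha> \<delta>"
  have fin: "finite {\<alpha>. x \<alpha> \<noteq> 0}" and sub: "{\<alpha>. x \<alpha> \<noteq> 0} \<subseteq> V"
    using assms(2) by (auto simp: digraph_module_def free_space_def)
  \<comment> \<open>Only the two ends of the edge at \<open>\<delta>\<close> can contribute to the coordinate \<open>\<delta>\<close>.\<close>
  have far: "tau_vertex \<Gamma> s \<alpha> \<delta> = 0" if "\<alpha> \<in> V" "\<alpha> \<noteq> src s \<delta>" "\<alpha> \<noteq> dst s \<delta>" for \<alpha>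
  proof -
    have "\<delta> \<noteq> src s \<alpha>" "\<delta> \<noteq> dst s \<alpha>"
      using that ends_cases[OF assms(1) that(1)] ends_idem[OF assms(1) that(1)] by metis+
    moreover have "\<delta> \<noteq> \<alpha>" using that ends_cases[OF assms(1,3)] by auto
    ultimately show ?thesis
      by (auto simp: tau_vertex_def Let_def vertex_vec_def source_end_def target_end_def)
  qed
  have "tau \<Gamma> s x \<delta> = (\<Sum>\<alpha> | x \<alpha> \<noteq> 0. ?f \<alpha>)"
    using assms(2) by (simp add: tau_def)
  also have "\<dots> = (\<Sum>\<alpha> \<in> {\<alpha>. x \<alpha> \<noteq> 0} \<union> {src s \<delta>, dst s \<delta>}. ?f \<alpha>)"
    using fin by (intro sum.mono_neutral_left) auto
  also have "\<dots> = (\<Sum>\<alpha> \<in> {src s \<delta>, dst s \<delta>}. ?f \<alpha>)"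
    using fin sub far by (intro sum.mono_neutral_right) auto
  also have "\<dots> = ?f (src s \<delta>) + ?f (dst s \<delta>)"
    using ends_distinct[OF assms(1,3)] by simp
  also have "\<dots> = fst (tau_coeff s \<delta>) * x (src s \<delta>) + snd (tau_coeff s \<delta>) * x (dst s \<delta>)"
  proof -
    have st: "tail (graph_of \<Gamma>) (edge_at \<Gamma> s \<delta>) = src s \<delta>"
      "head (graph_of \<Gamma>) (edge_at \<Gamma> s \<delta>) = dst s \<delta>"
      "edge_at \<Gamma> s (src s \<delta>) = edge_at \<Gamma> s \<delta>" "edge_at \<Gamma> s (dst s \<delta>) = edge_at \<Gamma> s \<delta>"
      using ends(5,6)[OF assms(1,3)]
      by (simp_all add: source_end_def target_end_def)
    show ?thesis
      using ends_cases[OF assms(1,3)] ends_distinct[OF assms(1,3)]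
      unfolding tau_vertex_def Let_def st tau_coeff_def vertex_vec_def
      by (auto simp: algebra_simps)
  qed
  finally show ?thesis .
qed

text \<open>
  On the two ends of a solid or dashed edge, \<open>tau \<Gamma> s\<close> has trace \<open>u\<^sup>2 - 1\<close> and determinant
  \<open>- u\<^sup>2\<close>; this is the relation of Cayley and Hamilton.
\<close>

lemma tau_quadratic:
  assumes "s \<in> S" "x \<in> carrier M" "tau \<Gamma> s x \<in> carrier M"
  shows "tau \<Gamma> s (tau \<Gamma> s x) = (\<lambda>\<delta>. (u\<^sup>2 - 1) * tau \<Gamma> s x \<delta> + u\<^sup>2 * x \<delta>)"
proof
  fix \<delta>
  show "tau \<Gamma> s (tau \<Gamma> s x) \<delta> = (u\<^sup>2 - 1) * tau \<Gamma> s x \<delta> + u\<^sup>2 * x \<delta>"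
  proof (cases "\<delta> \<in> V")
    case False
    then have "x \<delta> = 0" using assms(2) by (auto simp: digraph_module_def free_space_def)
    then show ?thesis using tau_outside False assms by simp
  next
    case True
    note e = ends[OF assms(1) True]
    note i = ends_idem[OF assms(1) True]
    from e(4) show ?thesis
    proof
      assume d: "\<delta> = src s \<delta>"
      show ?thesis
        using e(3) d unfolding tau_at[OF assms(1,3) True] tau_at[OF assms(1,2) True]
          tau_at[OF assms(1,2) e(1)] tau_at[OF assms(1,2) e(2)] i tau_coeff_def e(5,6)
        by (auto simp: algebra_simps power2_eq_square)
    next
      assume d: "\<delta> = dst s \<delta>"
      show ?thesis
        using e(3) d unfolding tau_at[OF assms(1,3) True] tau_at[OF assms(1,2) True]
          tau_at[OF assms(1,2) e(1)] tau_at[OF assms(1,2) e(2)] i tau_coeff_def e(5,6)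
        by (auto simp: algebra_simps power2_eq_square)
    qed
  qed
qed

text \<open>
  The inverse of \<open>tau \<Gamma> s\<close>, read off from the quadratic relation.
\<close>

definition tau_inv :: "'s \<Rightarrow> ('v \<Rightarrow> ratfun) \<Rightarrow> 'v \<Rightarrow> ratfun" where
  "tau_inv s x = (\<lambda>\<delta>. (tau \<Gamma> s x \<delta> - (u\<^sup>2 - 1) * x \<delta>) / u\<^sup>2)"

lemma u_nonzero [simp]: "u \<noteq> 0"
  using u_pos by simp

lemma tau_inv_closed:
  assumes "x \<in> carrier M" "tau \<Gamma> s x \<in> carrier M" shows "tau_inv s x \<in> carrier M"
proof -
  have "{\<delta>. tau_inv s x \<delta> \<noteq> 0} \<subseteq> {\<delta>. tau \<Gamma> s x \<delta> \<noteq> 0} \<union> {\<delta>. x \<delta> \<noteq> 0}"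
    by (auto simp: tau_inv_def)
  then show ?thesis
    using assms by (auto simp: digraph_module_def free_space_def elim: finite_subset)
qed

lemma tau_inv_tau:
  assumes "s \<in> S" "x \<in> carrier M" "tau \<Gamma> s x \<in> carrier M"
  shows "tau_inv s (tau \<Gamma> s x) = x"
  using tau_quadratic[OF assms] by (simp add: tau_inv_def)

lemma tau_tau_inv:
  assumes "s \<in> S" "x \<in> carrier M" "tau \<Gamma> s x \<in> carrier M"
  shows "tau \<Gamma> s (tau_inv s x) = x"
proof
  fix \<delta>
  have inv: "tau_inv s x \<in> carrier M" using tau_inv_closed assms by blast
  show "tau \<Gamma> s (tau_inv s x) \<delta> = x \<delta>"
  proof (cases "\<delta> \<in> V")
    case False
    then have "x \<delta> = 0" using assms(2) by (auto simp: digraph_module_def free_space_def)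
    then show ?thesis using tau_outside False assms inv by simp
  next
    case True
    have "tau \<Gamma> s (tau_inv s x) \<delta> = (tau \<Gamma> s (tau \<Gamma> s x) \<delta> - (u\<^sup>2 - 1) * tau \<Gamma> s x \<delta>) / u\<^sup>2"
      unfolding tau_at[OF assms(1) inv True] tau_at[OF assms(1,3) True] tau_at[OF assms(1,2) True]
      by (simp add: tau_inv_def field_simps)
    then show ?thesis using tau_quadratic[OF assms] by simp
  qed
qed

lemma ends_structure:
  assumes "s \<in> S" "\<delta> \<in> V"
  shows "\<delta> \<in> {src s \<delta>, dst s \<delta>} \<and> src s \<delta> \<noteq> dst s \<delta> \<and> dst s \<delta> \<in> V \<and>
      src s (src s \<delta>) = src s \<delta> \<and> src s (dst s \<delta>) = src s \<delta> \<and>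
      dst s (src s \<delta>) = dst s \<delta> \<and> dst s (dst s \<delta>) = dst s \<delta>"
  using ends[OF assms] ends_idem[OF assms] by auto

text \<open>
  At \<open>u = 0\<close> solid and dashed edges behave alike: \<open>tau \<Gamma> s\<close> sends the tail of an edge to its head
  \<open>\<beta>\<close>, and \<open>\<beta>\<close> to \<open>- \<beta>\<close>.
\<close>

lemma tau_leading:
  assumes "coefficient_ideal R I" "u \<in> I"
    and "s \<in> S" "x \<in> carrier M" "\<gamma> \<in> V" "coefficient_ideal.leading R I x \<gamma>"
  shows "coefficient_ideal.leading R I (tau \<Gamma> s x) (dst s \<gamma>)"
proof -
  interpret coefficient_ideal R I by fact
  have xR: "x \<delta> \<in> R" for \<delta> using assms(6) by (simp add: leading_def)
  show ?thesis
  proof (rule leading_step[OF assms(6,5) ends_structure[OF assms(3)] tau_outside[OF assms(3,4)]])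
    fix \<delta> assume d: "\<delta> \<in> V" "src s \<delta> = \<delta>"
    show "tau \<Gamma> s x \<delta> \<in> I"
      using d unfolding tau_at[OF assms(3,4) d(1)]
      by (simp add: tau_coeff_def xR \<open>u \<in> I\<close> ideal_intros power2_eq_square)
  next
    fix \<delta> assume d: "\<delta> \<in> V" "dst s \<delta> = \<delta>"
    have ne: "\<delta> \<noteq> src s \<delta>" using ends_distinct[OF assms(3) d(1)] d by auto
    have "tau \<Gamma> s x \<delta> - (x (src s \<delta>) - x \<delta>) =
      (if dashed \<Gamma> (edge_at \<Gamma> s \<delta>) then u * (x (src s \<delta>) + (u - 1) * x \<delta>) else u * (u * x \<delta>))"
      using d ne unfolding tau_at[OF assms(3,4) d(1)]
      by (simp add: tau_coeff_def algebra_simps power2_eq_square)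
    then show "tau \<Gamma> s x \<delta> - (x (src s \<delta>) - x \<delta>) \<in> I"
      by (simp add: xR \<open>u \<in> I\<close> ideal_intros)
  qed
qed

text \<open>
  At \<open>u = \<infinity>\<close> the inverse operator sends the head of an edge to its tail \<open>\<alpha>\<close>, and \<open>\<alpha>\<close>
  to \<open>- \<alpha>\<close>: the edges are reversed. With \<open>v = 1 / u\<close> the matrix of the inverse has
  polynomial entries in \<open>v\<close>.
\<close>

lemma tau_inv_leading:
  assumes "coefficient_ideal R I" "1 / u \<in> I"
    and "s \<in> S" "x \<in> carrier M" "\<gamma> \<in> V" "coefficient_ideal.leading R I x \<gamma>"
  shows "coefficient_ideal.leading R I (tau_inv s x) (src s \<gamma>)"
proof -
  interpret coefficient_ideal R I by fact
  define v where "v = 1 / u"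
  have v: "v \<in> I" using assms(2) by (simp add: v_def)
  have xR: "x \<delta> \<in> R" for \<delta> using assms(6) by (simp add: leading_def)
  show ?thesis
  proof (rule leading_step[OF assms(6,5)])
    fix \<delta> assume d: "\<delta> \<in> V"
    show "\<delta> \<in> {dst s \<delta>, src s \<delta>} \<and> dst s \<delta> \<noteq> src s \<delta> \<and> src s \<delta> \<in> V \<and>
      dst s (dst s \<delta>) = dst s \<delta> \<and> dst s (src s \<delta>) = dst s \<delta> \<and>
      src s (dst s \<delta>) = src s \<delta> \<and> src s (src s \<delta>) = src s \<delta>"
      using ends[OF assms(3) d] ends_idem[OF assms(3) d] by auto
  next
    fix \<delta> assume d: "\<delta> \<notin> V"
    then have "x \<delta> = 0" using assms(4) by (auto simp: digraph_module_def free_space_def)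
    then show "tau_inv s x \<delta> = 0" using tau_outside[OF assms(3,4) d] by (simp add: tau_inv_def)
  next
    fix \<delta> assume d: "\<delta> \<in> V" "dst s \<delta> = \<delta>"
    have ne: "\<delta> \<noteq> src s \<delta>" using ends_distinct[OF assms(3) d(1)] d by auto
    have "tau_inv s x \<delta> = (if dashed \<Gamma> (edge_at \<Gamma> s \<delta>)
      then v * ((1 + v) * x (src s \<delta>) - x \<delta>) else v * (v * x (src s \<delta>)))"
      using d ne unfolding tau_inv_def tau_at[OF assms(3,4) d(1)]
      by (simp add: tau_coeff_def field_simps power2_eq_square v_def)
    then show "tau_inv s x \<delta> \<in> I"
      by (simp add: xR v ideal_intros)
  next
    fix \<delta> assume d: "\<delta> \<in> V" "src s \<delta> = \<delta>"
    have "tau_inv s x \<delta> - (x (dst s \<delta>) - x \<delta>) = (if dashed \<Gamma> (edge_at \<Gamma> s \<delta>)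
      then v * ((v + 1) * x \<delta> - x (dst s \<delta>)) else v * (v * x \<delta>))"
      using d unfolding tau_inv_def tau_at[OF assms(3,4) d(1)]
      by (simp add: tau_coeff_def field_simps power2_eq_square v_def)
    then show "tau_inv s x \<delta> - (x (dst s \<delta>) - x \<delta>) \<in> I"
      by (simp add: xR v ideal_intros)
  qed
qed

end

section \<open>Connected components of a labeled digraph\<close>

text \<open>
  The subgraph induced on the vertices reachable from \<open>v\<close> is connected and contains every connected
  subgraph through \<open>v\<close>, so it is the only maximal one.
\<close>

lemma component_eq_induced:
  assumes "wf_digraph G" "C \<in> connected_components G" "v \<in> verts C"
  shows "C = G \<restriction> {w. v \<rightarrow>\<^sup>*\<^bsub>with_proj (mk_symmetric G)\<^esub> w}" (is "C = G \<restriction> ?R")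
proof -
  interpret wf_digraph G by fact
  interpret sym: pair_wf_digraph "mk_symmetric G" by (rule wellformed_mk_symmetric)
  have sub: "subgraph C G" and con: "connected C"
    and max: "\<And>D. subgraph C D \<Longrightarrow> subgraph D G \<Longrightarrow> connected D \<Longrightarrow> D = C"
    using assms(2) by (auto simp: connected_components_def max_subgraph_def)
  have vG: "v \<in> verts G" using sub assms(3) by auto
  have R: "?R \<subseteq> verts G"
    using sym.reachable_in_verts(2) by auto
  have R_sub: "subgraph (G \<restriction> ?R) G" using R by (rule subgraph_induce_subgraphI)
  interpret R: wf_digraph "G \<restriction> ?R" using R_sub by (auto simp: subgraph_def)
  interpret symR: pair_wf_digraph "mk_symmetric (G \<restriction> ?R)" by (rule R.wellformed_mk_symmetric)
  have reach: "v \<rightarrow>\<^sup>*\<^bsub>with_proj (mk_symmetric (G \<restriction> ?R))\<^esub> w"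
    if "v \<rightarrow>\<^sup>*\<^bsub>with_proj (mk_symmetric G)\<^esub> w" for w
    using that
  proof (induction rule: sym.reachable_induct)
    case base
    then show ?case using vG by (intro symR.reachable_refl) auto
  next
    case (step x y)
    have "v \<rightarrow>\<^sup>*\<^bsub>with_proj (mk_symmetric G)\<^esub> y"
      using step.hyps by (rule sym.reachable_adj_trans)
    then have "(x, y) \<in> parcs (mk_symmetric (G \<restriction> ?R))"
      using step.hyps by (auto simp: parcs_mk_symmetric)
    with step.IH show ?case by (rule symR.reachable_adj_trans)
  qed
  have "connected (G \<restriction> ?R)"
    unfolding connected_def
  proof (rule strongly_connectedI)
    have "v \<in> ?R" using vG by simp
    moreover have "verts (with_proj (mk_symmetric (G \<restriction> ?R))) = ?R" by simp
    ultimately show "verts (with_proj (mk_symmetric (G \<restriction> ?R))) \<noteq> {}" by blast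
    fix x y assume "x \<in> verts (with_proj (mk_symmetric (G \<restriction> ?R)))"
      "y \<in> verts (with_proj (mk_symmetric (G \<restriction> ?R)))"
    then have "v \<rightarrow>\<^sup>*\<^bsub>with_proj (mk_symmetric (G \<restriction> ?R))\<^esub> x" "v \<rightarrow>\<^sup>*\<^bsub>with_proj (mk_symmetric (G \<restriction> ?R))\<^esub> y"
      using reach by auto
    then show "x \<rightarrow>\<^sup>*\<^bsub>with_proj (mk_symmetric (G \<restriction> ?R))\<^esub> y"
      by (rule symR.reachable_trans[OF symmetric_reachable[OF symmetric_mk_symmetric]])
  qed
  moreover have "subgraph C (G \<restriction> ?R)"
  proof -
    have verts: "w \<in> ?R" if "w \<in> verts C" for w
    proof -
      have "v \<rightarrow>\<^sup>*\<^bsub>with_proj (mk_symmetric C)\<^esub> w"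
        using con that assms(3) by (auto simp: connected_def strongly_connected_def)
      then show ?thesis
        using sym.reachable_mono subgraph_mk_symmetric[OF sub] by blast
    qed
    interpret C: wf_digraph C using sub by (auto simp: subgraph_def)
    have "arcs C \<subseteq> arcs (G \<restriction> ?R)"
      using sub verts C.wellformed by (auto simp: subgraph_def compatible_def)
    then show ?thesis
      using sub verts R.wf_digraph C.wf_digraph
      by (auto simp: subgraph_def compatible_def)
  qed
  ultimately show ?thesis using max[of "G \<restriction> ?R"] R_sub by auto
qed

lemma components_eq:
  assumes "wf_digraph G" "C \<in> connected_components G" "D \<in> connected_components G"
    and "v \<in> verts C" "w \<in> verts D" "v \<rightarrow>\<^sup>*\<^bsub>with_proj (mk_symmetric G)\<^esub> w"
  shows "C = D"
proof -
  interpret wf_digraph G by fact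
  interpret sym: pair_wf_digraph "mk_symmetric G" by (rule wellformed_mk_symmetric)
  have "w \<rightarrow>\<^sup>*\<^bsub>with_proj (mk_symmetric G)\<^esub> v"
    using symmetric_reachable[OF symmetric_mk_symmetric] assms(6) .
  then have "{x. v \<rightarrow>\<^sup>*\<^bsub>with_proj (mk_symmetric G)\<^esub> x} = {x. w \<rightarrow>\<^sup>*\<^bsub>with_proj (mk_symmetric G)\<^esub> x}"
    using sym.reachable_trans[OF assms(6)] sym.reachable_trans[of w v] by auto
  then show ?thesis
    using component_eq_induced[OF assms(1,2,4)] component_eq_induced[OF assms(1,3,5)] by simp
qed

lemma component_nonempty: "C \<in> connected_components G \<Longrightarrow> verts C \<noteq> {} \<and> verts C \<subseteq> verts G"
  by (auto simp: connected_components_def pre_digraph.max_subgraph_def connected_def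
      strongly_connected_def)

lemma (in labeled_graph) restrict_labels_wf: "wf_digraph (graph_of (restrict_labels \<Gamma> J))"
  by unfold_locales (auto simp: restrict_labels_def)

lemma (in labeled_graph) reachable_target:
  assumes "s \<in> S" "s \<in> J" "\<alpha> \<in> V"
  shows "\<alpha> \<rightarrow>\<^sup>*\<^bsub>with_proj (mk_symmetric (graph_of (restrict_labels \<Gamma> J)))\<^esub> dst s \<alpha>"
proof -
  let ?G = "graph_of (restrict_labels \<Gamma> J)"
  interpret G: wf_digraph ?G by (rule restrict_labels_wf)
  interpret sym: pair_wf_digraph "mk_symmetric ?G" by (rule G.wellformed_mk_symmetric)
  show ?thesis
  proof (cases "\<alpha> = dst s \<alpha>")
    case True
    then show ?thesis using sym.reachable_refl[of \<alpha>] assms by (simp add: restrict_labels_def)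
  next
    case False
    have "edge_at \<Gamma> s \<alpha> \<in> arcs ?G" "tail ?G (edge_at \<Gamma> s \<alpha>) = \<alpha>" "head ?G (edge_at \<Gamma> s \<alpha>) = dst s \<alpha>"
      using edge_at[OF assms(1,3)] False assms(2)
      by (auto simp: restrict_labels_def incident_edge_def target_end_def)
    then have "(\<alpha>, dst s \<alpha>) \<in> parcs (mk_symmetric ?G)"
      by (force simp: parcs_mk_symmetric)
    then show ?thesis by (intro sym.reachable_adjI) simp
  qed
qed

lemma (in labeled_graph) constant_if_connected:
  assumes "connected (graph_of \<Gamma>)"
    and inv: "\<And>s \<alpha>. s \<in> S \<Longrightarrow> \<alpha> \<in> V \<Longrightarrow> F (src s \<alpha>) = F (dst s \<alpha>)"
    and "\<alpha> \<in> V" "\<beta> \<in> V"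
  shows "F \<alpha> = F \<beta>"
proof -
  interpret sym: pair_wf_digraph "mk_symmetric (graph_of \<Gamma>)" by (rule wellformed_mk_symmetric)
  have edge: "F (tail (graph_of \<Gamma>) e) = F (head (graph_of \<Gamma>) e)" if e: "e \<in> arcs (graph_of \<Gamma>)" for e
  proof -
    let ?s = "label \<Gamma> e" and ?a = "tail (graph_of \<Gamma>) e"
    have "?s \<in> S" "?a \<in> V" using labeled e by (auto simp: S_labeled_digraph_def)
    moreover from this have "edge_at \<Gamma> ?s ?a = e"
      by (rule edge_at_eqI) (use e in \<open>auto simp: incident_edge_def\<close>)
    ultimately show ?thesis
      using inv[of ?s ?a] by (simp add: source_end_def target_end_def)
  qed
  have "\<alpha> \<rightarrow>\<^sup>*\<^bsub>with_proj (mk_symmetric (graph_of \<Gamma>))\<^esub> \<beta>"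
    using assms by (auto simp: connected_def strongly_connected_def)
  then show ?thesis
    by (induction rule: sym.reachable_induct) (auto simp: parcs_mk_symmetric edge)
qed

section \<open>Connected W-digraphs of finite Coxeter groups\<close>

text \<open>
  Applying the operators to a single vertex keeps track of a leading vertex, which moves by \<open>d\<close>.
  Equal vectors have the same leading vertex, so the maps \<open>d s\<close> inherit the consistency of the
  operators.
\<close>

lemma (in coxeter_group) word_consistent_leading:
  assumes "coefficient_ideal R I" "word_consistent W S X D"
    and step: "\<And>s x \<gamma>. s \<in> S \<Longrightarrow> x \<in> X \<Longrightarrow> \<gamma> \<in> V \<Longrightarrow> coefficient_ideal.leading R I x \<gamma> \<Longrightarrow>
      coefficient_ideal.leading R I (D s x) (d s \<gamma>)"
    and d: "\<And>s. s \<in> S \<Longrightarrow> d s \<in> V \<rightarrow> V"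
    and vec: "\<And>\<gamma>. \<gamma> \<in> V \<Longrightarrow> vertex_vec \<gamma> \<in> X"
  shows "word_consistent W S V d"
proof -
  interpret coefficient_ideal R I by fact
  have D: "D s \<in> X \<rightarrow> X" if "s \<in> S" for s
    using assms(2) that by (auto simp: word_consistent_def)
  have lead: "leading (foldr D xs (vertex_vec \<gamma>)) (foldr d xs \<gamma>)"
    if "xs \<in> lists S" "\<gamma> \<in> V" for xs \<gamma>
    using that
  proof (induction xs)
    case Nil
    then show ?case by (simp add: leading_vertex_vec)
  next
    case (Cons s xs)
    have "foldr D xs (vertex_vec \<gamma>) \<in> X" "foldr d xs \<gamma> \<in> V"
      using foldr_closed[OF Cons.hyps(2), of D X] foldr_closed[OF Cons.hyps(2), of d V] D d vec
        Cons.prems by blast+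
    then show ?case using step Cons by simp
  qed
  have "foldr d xs \<gamma> = foldr d ys \<gamma>"
    if r: "red xs" "red ys" "wp xs = wp ys" and g: "\<gamma> \<in> V" for xs ys \<gamma>
  proof -
    have "foldr D xs (vertex_vec \<gamma>) = foldr D ys (vertex_vec \<gamma>)"
      by (rule word_consistentD[OF assms(2) r vec[OF g]])
    then show ?thesis
      using lead[of xs \<gamma>] lead[of ys \<gamma>] r g leading_unique by (metis reduced_word_def)
  qed
  then show ?thesis using d unfolding word_consistent_def by blast
qed

locale coxeter_digraph = coxeter_group W S + labeled_graph S \<Gamma>
  for W :: "('a, 'm) monoid_scheme" (structure) and S and \<Gamma> :: "('v, 'e, 'a) labeled_digraph"
begin

lemma tau_word_consistent:
  assumes "hecke_algebra W S H T" "W_digraph S H T \<Gamma>"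
  shows "word_consistent W S (carrier M) (tau \<Gamma>)"
proof -
  let ?E = "operator_algebra ratfun_ring M"
  obtain \<phi> where \<phi>: "\<phi> \<in> algebra_hom ratfun_ring H ?E" and gen: "\<And>s. s \<in> S \<Longrightarrow> \<phi> (T s) = tau \<Gamma> s"
    using assms(2) by (auto simp: W_digraph_def)
  have T: "T w \<in> carrier H" if "w \<in> carrier W" for w
    using assms(1) that by (auto simp: hecke_algebra_def indexed_basis_def)
  have closed: "\<phi> (T w) \<in> carrier M \<rightarrow> carrier M" if "w \<in> carrier W" for w
  proof -
    have "\<phi> (T w) \<in> carrier ?E" using \<phi> T[OF that] by (auto simp: algebra_hom_def ring_hom_def)
    then show ?thesis by (auto simp: operator_algebra_def linear_operators_def)
  qed
  show ?thesis
  proof (rule word_consistent_if_hecke_rule[where P = "\<lambda>w. \<phi> (T w)"])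
    fix s assume "s \<in> S"
    then show "tau \<Gamma> s \<in> carrier M \<rightarrow> carrier M" using closed[of s] gen by simp
  next
    fix s w x
    assume s: "s \<in> S" and w: "w \<in> carrier W" and len: "len w < len (s \<otimes> w)" and x: "x \<in> carrier M"
    have "T s \<otimes>\<^bsub>H\<^esub> T w = T (s \<otimes> w)"
      using assms(1) s w len by (simp add: hecke_algebra_def)
    then have "\<phi> (T (s \<otimes> w)) = \<phi> (T s) \<otimes>\<^bsub>?E\<^esub> \<phi> (T w)"
      using \<phi> T[OF w] T[OF S_closed[OF s]]
      unfolding algebra_hom_def ring_hom_def by fastforce
    then show "\<phi> (T (s \<otimes> w)) x = tau \<Gamma> s (\<phi> (T w) x)"
      using x gen[OF s] by (simp add: operator_algebra_def compose_def)
  qed (use gen in auto)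
qed

text \<open>
  Specializing \<open>tau \<Gamma>\<close> at \<open>u = 0\<close> gives the action by heads, and specializing the inverse operators
  at infinity gives the action by tails.
\<close>

lemma ends_word_consistent:
  assumes "word_consistent W S (carrier M) (tau \<Gamma>)"
  shows "word_consistent W S V dst" "word_consistent W S V src"
proof -
  have tau: "tau \<Gamma> s x \<in> carrier M" if "s \<in> S" "x \<in> carrier M" for s x
    using assms that by (auto simp: word_consistent_def)
  have vec: "vertex_vec \<gamma> \<in> carrier M" if "\<gamma> \<in> V" for \<gamma>
    using that by (auto simp: digraph_module_def free_space_def vertex_vec_def)
  show "word_consistent W S V dst"
    by (rule word_consistent_leading[OF coefficient_ideal_at_zero assms
          tau_leading[OF coefficient_ideal_at_zero u_in_ideal_at_zero]])
      (auto simp: vec ends_closed)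
  have "word_consistent W S (carrier M) tau_inv"
    by (rule inverse_word_consistent[OF assms])
      (auto simp: tau tau_inv_closed tau_tau_inv tau_inv_tau)
  then show "word_consistent W S V src"
    by (rule word_consistent_leading[OF coefficient_ideal_at_infinity _
          tau_inv_leading[OF coefficient_ideal_at_infinity inverse_u_infinitesimal]])
      (auto simp: vec ends_closed)
qed

text \<open>
  The longest element, acting by tails, sends the two ends of each edge to the same vertex, and
  hence by connectedness all vertices to one vertex \<open>\<sigma>\<close>. Each step of this action either rests
  or goes from the head of an edge to its tail, so retracing the steps that move leads from
  \<open>\<sigma>\<close> back to any given vertex by the action by heads, and the word used for this may be replaced
  by a reduced one. Thus \<open>f w\<close>, the image of \<open>\<sigma>\<close> under a reduced word for \<open>w\<close>, exhausts the
  vertices.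
\<close>

lemma vertices_indexed_by_group:
  assumes "finite (carrier W)" "connected (graph_of \<Gamma>)"
    and dst: "word_consistent W S V dst" and src: "word_consistent W S V src"
  obtains f where "f \<in> carrier W \<rightarrow> V" "V \<subseteq> f ` carrier W"
    "\<And>s w. s \<in> S \<Longrightarrow> w \<in> carrier W \<Longrightarrow> f (s \<otimes> w) = dst s (f w) \<or> f w = dst s (f (s \<otimes> w))"
proof -
  obtain zs where zs: "zs \<in> lists S"
    and absorb: "\<And>s \<alpha>. s \<in> S \<Longrightarrow> \<alpha> \<in> V \<Longrightarrow> foldr src zs (src s \<alpha>) = foldr src zs \<alpha>"
    using longest_word_absorbs[OF assms(1) src] ends_idem by metis
  obtain root where root: "root \<in> V"
    using assms(2) by (auto simp: connected_def strongly_connected_def)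
  define \<sigma> where "\<sigma> = foldr src zs root"
  have \<sigma>_V: "\<sigma> \<in> V"
    unfolding \<sigma>_def using zs root ends_closed by (intro foldr_closed[of _ S]) auto
  have const: "foldr src zs \<alpha> = \<sigma>" if "\<alpha> \<in> V" for \<alpha>
    unfolding \<sigma>_def
  proof (rule constant_if_connected[OF assms(2) _ that root])
    fix s \<beta> assume "s \<in> S" "\<beta> \<in> V"
    then show "foldr src zs (src s \<beta>) = foldr src zs (dst s \<beta>)"
      using absorb[of s \<beta>] absorb[of s "dst s \<beta>"] ends_closed ends_idem by simp
  qed
  have undo: "\<exists>ys \<in> lists S. foldr dst ys (foldr src xs \<alpha>) = \<alpha>" if "xs \<in> lists S" "\<alpha> \<in> V" for xs \<alpha>
    using that
  proof (induction xs)
    case Nil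
    then show ?case by (intro bexI[of _ "[]"]) auto
  next
    case (Cons s xs)
    let ?b = "foldr src xs \<alpha>"
    obtain ys where ys: "ys \<in> lists S" "foldr dst ys ?b = \<alpha>" using Cons by auto
    have b: "?b \<in> V" using Cons ends_closed by (intro foldr_closed[of _ S]) auto
    from ends_cases[OF Cons.hyps(1) b] show ?case
    proof
      assume "?b = src s ?b"
      then show ?thesis using ys by (intro bexI[of _ ys]) auto
    next
      assume "?b = dst s ?b"
      then show ?thesis
        using ys ends_idem[OF Cons.hyps(1) b] Cons.hyps by (intro bexI[of _ "ys @ [s]"]) auto
    qed
  qed
  define word where "word w = (SOME xs. red xs \<and> wp xs = w)" for w
  have word: "red (word w) \<and> wp (word w) = w" if w: "w \<in> carrier W" for w
  proof -
    obtain xs where "red xs" "wp xs = w" using reduced_exists[OF w] .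
    then have "\<exists>xs. red xs \<and> wp xs = w" by blast
    then show ?thesis unfolding word_def by (rule someI_ex)
  qed
  define f where "f w = foldr dst (word w) \<sigma>" for w
  have f: "f w = foldr dst xs \<sigma>" if "red xs" "wp xs = w" "w \<in> carrier W" for w xs
    unfolding f_def
    by (rule word_consistentD[OF dst _ that(1) _ \<sigma>_V]) (simp_all add: word[OF that(3)] that(2))
  show ?thesis
  proof
    show "f \<in> carrier W \<rightarrow> V"
    proof
      fix w assume "w \<in> carrier W"
      then show "f w \<in> V"
        unfolding f_def using word[of w] \<sigma>_V ends_closed
        by (intro foldr_closed[of _ S]) (auto simp: reduced_word_def)
    qed
    show "V \<subseteq> f ` carrier W"
    proof
      fix \<alpha> assume \<alpha>: "\<alpha> \<in> V"
      then obtain ys where ys: "ys \<in> lists S" "foldr dst ys \<sigma> = \<alpha>"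
        using undo[OF zs \<alpha>] const by auto
      obtain xs where xs: "red xs" "foldr dst xs \<sigma> = \<alpha>"
        using orbit_reduced[OF dst _ ys(1) \<sigma>_V] ends_idem ys(2) by metis
      have "wp xs \<in> carrier W" using xs by (auto simp: reduced_word_def)
      then show "\<alpha> \<in> f ` carrier W" using f[OF xs(1) HOL.refl] xs(2) by force
    qed
    fix s w assume s: "s \<in> S" and w: "w \<in> carrier W"
    have sw: "s \<otimes> w \<in> carrier W" using s w by auto
    show "f (s \<otimes> w) = dst s (f w) \<or> f w = dst s (f (s \<otimes> w))"
    proof (cases "red (s # word w)")
      case True
      then show ?thesis using f[OF True _ sw] word[OF w] by (simp add: f_def)
    next
      case False
      then obtain ys where ys: "red (s # ys)" "wp (s # ys) = w" "wp ys = s \<otimes> w"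
        using not_reduced_Cons[of "word w" s] word[OF w] s by metis
      then show ?thesis
        using f[OF ys(1,2) w] f[OF reduced_tail[OF ys(1)] ys(3) sw] by simp
    qed
  qed
qed

lemma reachable_along_parabolic:
  assumes "J \<subseteq> S" "f \<in> carrier W \<rightarrow> V"
    and step: "\<And>s w. s \<in> S \<Longrightarrow> w \<in> carrier W \<Longrightarrow>
      f (s \<otimes> w) = dst s (f w) \<or> f w = dst s (f (s \<otimes> w))"
    and "h \<in> parabolic W J" "w \<in> carrier W"
  shows "f w \<rightarrow>\<^sup>*\<^bsub>with_proj (mk_symmetric (graph_of (restrict_labels \<Gamma> J)))\<^esub> f (h \<otimes> w)"
    (is "_ \<rightarrow>\<^sup>*\<^bsub>?G\<^esub> _")
proof -
  interpret J: wf_digraph "graph_of (restrict_labels \<Gamma> J)" by (rule restrict_labels_wf)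
  interpret sym: pair_wf_digraph "mk_symmetric (graph_of (restrict_labels \<Gamma> J))"
    by (rule J.wellformed_mk_symmetric)
  have JW: "J \<subseteq> carrier W" using assms(1) S_carrier by auto
  have gen: "f w \<rightarrow>\<^sup>*\<^bsub>?G\<^esub> f (s \<otimes> w)" if s: "s \<in> J" and w: "w \<in> carrier W" for s w
  proof -
    have sS: "s \<in> S" using s assms(1) by auto
    have V: "f w \<in> V" "f (s \<otimes> w) \<in> V" using assms(2) w sS by auto
    show ?thesis
      using step[OF sS w] reachable_target[OF sS s V(1)] reachable_target[OF sS s V(2)]
        symmetric_reachable[OF symmetric_mk_symmetric] by metis
  qed
  show ?thesis
    using assms(4,5)
  proof (induction arbitrary: w)
    case one
    have "f w \<in> V" using one assms(2) by auto
    then show ?case using sym.reachable_refl[of "f w"] one by (simp add: restrict_labels_def)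
  next
    case (incl h)
    then show ?case by (rule gen)
  next
    case (inv h)
    then show ?case using gen assms(1) by (metis generator_inv subsetD)
  next
    case (eng h1 h2)
    have c: "h1 \<in> carrier W" "h2 \<in> carrier W"
      using eng.hyps generate_in_carrier[OF JW] by auto
    then have "f w \<rightarrow>\<^sup>*\<^bsub>?G\<^esub> f (h2 \<otimes> w)" "f (h2 \<otimes> w) \<rightarrow>\<^sup>*\<^bsub>?G\<^esub> f (h1 \<otimes> (h2 \<otimes> w))"
      using eng.IH eng.prems by auto
    then show ?case
      using sym.reachable_trans c eng.prems by (simp add: m_assoc)
  qed
qed

text \<open>
  By the preceding lemma the component of \<open>f w\<close> depends only on the coset of \<open>w\<close>. Choosing in
  each component a vertex \<open>f w\<close> therefore embeds the components into the right cosets of \<open>W\<^sub>J\<close>.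
\<close>

lemma card_components_le_index:
  assumes "finite (carrier W)" "J \<subseteq> S" "f \<in> carrier W \<rightarrow> V" "V \<subseteq> f ` carrier W"
    and step: "\<And>s w. s \<in> S \<Longrightarrow> w \<in> carrier W \<Longrightarrow>
      f (s \<otimes> w) = dst s (f w) \<or> f w = dst s (f (s \<otimes> w))"
  defines "K \<equiv> connected_components (graph_of (restrict_labels \<Gamma> J))"
  shows "finite K \<and> card K \<le> group_index W (parabolic W J)"
proof -
  let ?G = "graph_of (restrict_labels \<Gamma> J)"
  have JW: "J \<subseteq> carrier W" using assms(2) S_carrier by auto
  have "\<exists>w. w \<in> carrier W \<and> f w \<in> verts C" if "C \<in> K" for C
  proof -
    have "verts C \<noteq> {}" "verts C \<subseteq> V"
      using component_nonempty[of C ?G] that by (auto simp: K_def restrict_labels_def)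
    then show ?thesis using assms(4) by blast
  qed
  then obtain rep where rep: "\<And>C. C \<in> K \<Longrightarrow> rep C \<in> carrier W \<and> f (rep C) \<in> verts C"
    by metis
  let ?coset = "\<lambda>C. parabolic W J #> rep C"
  have "inj_on ?coset K"
  proof (rule inj_onI)
    fix C D assume C: "C \<in> K" and D: "D \<in> K" and eq: "?coset C = ?coset D"
    have "rep D \<in> ?coset D"
      using rcos_self[OF _ generate_is_subgroup[OF JW]] rep[OF D] by blast
    then obtain h where h: "h \<in> parabolic W J" "rep D = h \<otimes> rep C"
      using eq unfolding r_coset_def by blast
    then have "f (rep C) \<rightarrow>\<^sup>*\<^bsub>with_proj (mk_symmetric ?G)\<^esub> f (rep D)"
      using reachable_along_parabolic[OF assms(2,3) step h(1)] rep[OF C] by simp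
    then show "C = D"
      using components_eq[OF restrict_labels_wf] C D rep by (metis K_def)
  qed
  moreover have "?coset ` K \<subseteq> rcosets parabolic W J"
    using rep by (auto simp: RCOSETS_def)
  moreover have "finite (rcosets parabolic W J)"
    using assms(1) by (auto simp: RCOSETS_def)
  ultimately show ?thesis
    unfolding group_index_def using inj_on_finite card_inj_on_le by metis
qed

end

theorem theorem1p8:
  fixes W :: "'a monoid"
    and S J :: "'a set"
    and H :: "(ratfun, 'h) module"
    and T :: "'a \<Rightarrow> 'h"
    and \<Gamma> :: "('v, 'e, 'a) labeled_digraph"
  assumes "coxeter_system W S"
    and "hecke_algebra W S H T"
    and "finite (carrier W)"
    and "J \<subseteq> S"
    and "W_digraph S H T \<Gamma>"
    and "connected (graph_of \<Gamma>)"
  shows "finite (connected_components (graph_of (restrict_labels \<Gamma> J))) \<and>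
         card (connected_components (graph_of (restrict_labels \<Gamma> J)))
           \<le> group_index W (parabolic W J)"
proof -
  interpret group W
    using assms(1) by (auto simp: coxeter_system_def has_presentation_def)
  interpret coxeter_digraph W S \<Gamma>
    using assms(1,5) by unfold_locales (auto simp: W_digraph_def)
  note ends = ends_word_consistent[OF tau_word_consistent[OF assms(2,5)]]
  obtain f where "f \<in> carrier W \<rightarrow> V" "V \<subseteq> f ` carrier W"
    "\<And>s w. s \<in> S \<Longrightarrow> w \<in> carrier W \<Longrightarrow>
      f (s \<otimes>\<^bsub>W\<^esub> w) = dst s (f w) \<or> f w = dst s (f (s \<otimes>\<^bsub>W\<^esub> w))"
    using vertices_indexed_by_group[OF assms(3,6) ends] by blast
  then show ?thesis
    by (rule card_components_le_index[OF assms(3,4)])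
qed

end
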